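(* Let $\alpha\in(\tfrac13,\tfrac12)$, $T>0$, let $(\Omega,\mathfrak F,(\mathfrak F_t)_{t\in[0,T]},\mathbb P)$ be a filtered probability space satisfying the usual conditions, $\mathbf X\in\mathscr C^\alpha([0,T];\mathbb R^{d_X})$ deterministic, and let $(Y,\partial_XY,\partial_X^2Y,\dot Y;M,N)$ be an $\mathbb R^{d_Y}$-valued $\mathbf X$-scRSM. Put $E:=\mathbb R^{d_X}\oplus\mathbb R^{d_Y}\oplus\mathcal L(\mathbb R^{d_X};\mathbb R^{d_Y})$. Then the continuous adapted processes $Y',Y''$ with values in $\mathcal L(E;\mathbb R^{d_Y})$ and $\mathcal L(E^{\otimes2};\mathbb R^{d_Y})$ given by $$Y'_t(z_1\oplus z_2\oplus z_3)=\partial_XY_t\,z_1+z_2,\qquad Y''_t\big((y_1\oplus y_2\oplus y_3)\otimes(z_1\oplus z_2\oplus z_3)\big)=\partial_X^2Y_t(y_1\otimes z_1)+y_3z_1,$$ i.e. in block notation $$Y'=\begin{pmatrix}\partial_XY\\\mathrm{Id}\\0\end{pmatrix},\qquad Y''=\begin{pmatrix}\partial_X^2Y&0&0\\0&0&0\\\mathrm{Id}&0&0\end{pmatrix},$$ satisfy $(Y-V,Y',Y'',0)\in\mathscr D^{3\alpha}_{(\mathbf X;M;N)}([0,T];\mathbb R^{d_Y})$ almost surely, where $V=\int_0^\cdot\dot Y_s\,ds$ and $(\mathbf X;M;N)$ is the joint lift.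
   Context: Conventions: $\delta X_{s,t}=X_t-X_s$, $\Delta_T=\{0\le s<t\le T\}$; $\mathcal L(E_1;\mathcal L(E_2;U))\cong\mathcal L(E_1\otimes E_2;U)$, $Ae_1=A(e_1\otimes\cdot)$; $(v\otimes w)^\top=w\otimes v$. Rough paths. $(X,\mathbb X)\in\mathscr C^\alpha([0,T];V)$: $X$ $\alpha$-Hölder, $|\mathbb X_{s,t}|\lesssim|t-s|^{2\alpha}$, $\mathbb X_{s,t}-\mathbb X_{s,u}-\mathbb X_{u,t}=\delta X_{s,u}\otimes\delta X_{u,t}$. $\mathscr D^{2\alpha}_X([0,T];W)$: pairs $(Y,Y')$ with $Y'$ $\mathcal L(V;W)$-valued $\alpha$-Hölder and $|\delta Y_{s,t}-Y'_s\delta X_{s,t}|\lesssim|t-s|^{2\alpha}$. $\mathscr D^{3\alpha}_{\mathbf X}([0,T];W)$ (for any $\mathbf X\in\mathscr C^\alpha$): $(Y,Y',Y'',\dot Y)$ with $|\delta Y_{s,t}-Y_s'\delta X_{s,t}-Y_s''\mathbb X_{s,t}-\dot Y_s(t-s)|\lesssim|t-s|^{3\alpha}$, $(Y',Y'')\in\mathscr D^{2\alpha}_X([0,T];\mathcal L(V;W))$, $\dot Y$ $\alpha$-Hölder. For $\mathcal L(V;W)$-valued $(Y,Y')\in\mathscr D^{2\alpha}_X$, $\int(Y,Y')d\mathbf X=\lim\sum Y_u\delta X_{u,v}+Y_u'\mathbb X_{u,v}$. Martingales. $\mathcal M^{c,\mathrm{loc},1}(W)$: $W$-valued continuous local martingales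 whose quadratic variation is a.s. Lipschitz on $[0,T]$. For $L\in\mathcal M^{c,\mathrm{loc},1}$: $\mathbb L_{s,t}=\int_s^t\delta L_{s,r}\otimes dL_r$, $\Pi(X;L)_{s,t}=\int_s^t\delta X_{s,r}\otimes dL_r$ (Itô), $\Pi(L;X)_{s,t}=\delta L_{s,t}\otimes\delta X_{s,t}-\Pi(X;L)_{s,t}^\top$, $\int_s^tL_r\otimes dX_r=\Pi(L;X)_{s,t}+L_s\otimes\delta X_{s,t}$. The joint lift is $(\mathbf X;L)=\Big(\begin{pmatrix}X\\L\end{pmatrix},\begin{pmatrix}\mathbb X&\Pi(X;L)\\\Pi(L;X)&\mathbb L\end{pmatrix}\Big)$ and $(\mathbf X;M;N):=(\mathbf X;L)$ with $L=(M,N)^\top$; it is a.s. an $\alpha$-Hölder rough path. $(Y,\partial_XY;M)$ is an $X$-controlled $\alpha$-Hölder rough semimartingale if $M\in\mathcal M^{c,\mathrm{loc},1}$, $(Y,\partial_XY)$ is continuous adapted, and $(Y-M,\partial_XY)\in\mathscr D^{2\alpha}_X$ a.s. For $\mathcal L(V;W)$-valued such triples, $\int_0^t(Y,\partial_XY)d\mathbf X:=\int_0^t(Y-M,\partial_XY)d\mathbf X+\int_0^tM_r\,dX_r$ (pathwise rough integral plus contraction of the integration-by-parts integral). $\mathbf X$-scRSM (strongly $\mathbf X$-controlled rough semimartingale): a tuple $(Y,\partial_XY,\partial_X^2Y,\dot Y;M,N)$ of adapted processes with values in $\mathbb R^{d_Y}$, $\mathcal L(\mathbb R^{d_X};\mathbb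 R^{d_Y})$, $\mathcal L((\mathbb R^{d_X})^{\otimes2};\mathbb R^{d_Y})$, $\mathbb R^{d_Y}$, $\mathbb R^{d_Y}$, $\mathcal L(\mathbb R^{d_X};\mathbb R^{d_Y})$, all continuous except $\dot Y$, which is progressively measurable with a.s. $\dot Y\in L^\infty([0,T])$; $(\partial_XY,\partial_X^2Y;N)$ is an $X$-controlled rough semimartingale, $M\in\mathcal M^{c,\mathrm{loc},1}(\mathbb R^{d_Y})$, and a.s. for all $t$, $Y_t=Y_0+\int_0^t\dot Y_sds+M_t+\int_0^t(\partial_XY,\partial_X^2Y)_sd\mathbf X_s$. *)

theory Defs
  imports "HOL-Probability.Probability"
begin

section \<open>Tensors\<close>

text \<open>
  For Euclidean spaces \<open>V\<close>, \<open>W\<close> the tensor product \<open>V \<otimes> W\<close> is represented by the linear maps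
  \<open>V \<Rightarrow> W\<close>, with \<open>v \<otimes> w\<close> the rank-one map \<open>x \<mapsto> (x \<bullet> v) w\<close>; the coefficient of \<open>i \<otimes> j\<close>
  (\<open>i\<close>, \<open>j\<close> basis vectors) in a tensor \<open>S\<close> is thus \<open>S i \<bullet> j\<close>.
  Linear maps on \<open>V \<otimes> W\<close> are given in curried form, \<open>A v w\<close> standing for \<open>A (v \<otimes> w)\<close>.
\<close>

definition tensor :: "'v::euclidean_space \<Rightarrow> 'w::euclidean_space \<Rightarrow> 'v \<Rightarrow>\<^sub>L 'w"
  where "tensor v w = blinfun_scaleR_left w o\<^sub>L blinfun_inner_left v"

lemma tensor_apply [simp]: "blinfun_apply (tensor v w) x = (x \<bullet> v) *\<^sub>R w"
  by (simp add: tensor_def)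

definition tensor_transpose :: "('v::euclidean_space \<Rightarrow>\<^sub>L 'w::euclidean_space) \<Rightarrow> 'w \<Rightarrow>\<^sub>L 'v"
  where "tensor_transpose S = Blinfun (adjoint (blinfun_apply S))"

lemma tensor_transpose_inner: "x \<bullet> blinfun_apply (tensor_transpose S) y = blinfun_apply S x \<bullet> y"
proof -
  have lin: "linear (blinfun_apply S)"
    by (simp add: blinfun.bounded_linear_right bounded_linear.linear)
  then have "bounded_linear (adjoint (blinfun_apply S))"
    by (simp add: adjoint_linear linear_conv_bounded_linear[symmetric])
  then show ?thesis
    by (simp add: tensor_transpose_def bounded_linear_Blinfun_apply adjoint_works[OF lin])
qed

lemma tensor_transpose_tensor: "tensor_transpose (tensor v w) = tensor w v"
proof (rule blinfun_eqI)
  fix y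
  show "blinfun_apply (tensor_transpose (tensor v w)) y = blinfun_apply (tensor w v) y"
    by (rule vector_eq_rdot[THEN iffD1])
      (metis inner_commute inner_scaleR_left tensor_apply tensor_transpose_inner mult.commute)
qed

text \<open>The value at \<open>S\<close> of the linear map on \<open>V \<otimes> W\<close> that extends the bilinear map \<open>B\<close>.\<close>

definition tensor_lift ::
    "('v::euclidean_space \<Rightarrow> 'w::euclidean_space \<Rightarrow> 'u::real_vector) \<Rightarrow> ('v \<Rightarrow>\<^sub>L 'w) \<Rightarrow> 'u"
  where "tensor_lift B S = (\<Sum>i\<in>Basis. B i (blinfun_apply S i))"

lemma tensor_lift_tensor:
  fixes B :: "'v::euclidean_space \<Rightarrow> 'w::euclidean_space \<Rightarrow> 'u::real_normed_vector"
  assumes "bounded_bilinear B"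
  shows "tensor_lift B (tensor v w) = B v w"
proof -
  interpret bounded_bilinear B by fact
  have "B v w = B (\<Sum>i\<in>Basis. (v \<bullet> i) *\<^sub>R i) w"
    by (simp add: euclidean_representation)
  also have "\<dots> = (\<Sum>i\<in>Basis. B i ((i \<bullet> v) *\<^sub>R w))"
    by (simp add: sum_left scaleR_left scaleR_right inner_commute)
  finally show ?thesis
    by (simp add: tensor_lift_def)
qed

text \<open>
  The element of \<open>(V \<oplus> U) \<otimes> (V \<oplus> U)\<close> with blocks \<open>A \<in> V \<otimes> V\<close>, \<open>B \<in> V \<otimes> U\<close>, \<open>C \<in> U \<otimes> V\<close>,
  \<open>D \<in> U \<otimes> U\<close>.
\<close>

definition tensor_block ::
    "('v::euclidean_space \<Rightarrow>\<^sub>L 'v) \<Rightarrow> ('v \<Rightarrow>\<^sub>L 'u::euclidean_space) \<Rightarrow> ('u \<Rightarrow>\<^sub>L 'v) \<Rightarrow> ('u \<Rightarrow>\<^sub>L 'u)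
      \<Rightarrow> ('v \<times> 'u) \<Rightarrow>\<^sub>L ('v \<times> 'u)"
  where "tensor_block A B C D =
    Blinfun (\<lambda>(x, y). (blinfun_apply A x + blinfun_apply C y, blinfun_apply B x + blinfun_apply D y))"

lemma tensor_block_apply:
  "blinfun_apply (tensor_block A B C D) (x, y) =
    (blinfun_apply A x + blinfun_apply C y, blinfun_apply B x + blinfun_apply D y)"
proof -
  have "bounded_linear (\<lambda>(x, y). (blinfun_apply A x + blinfun_apply C y,
                                    blinfun_apply B x + blinfun_apply D y))"
    unfolding case_prod_beta by (intro bounded_linear_intros)
  then show ?thesis
    by (simp add: tensor_block_def bounded_linear_Blinfun_apply)
qed

lemma tensor_block_tensor:
  "tensor_block (tensor v v') (tensor v u') (tensor u v') (tensor u u') = tensor (v, u) (v', u')"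
  by (rule blinfun_eqI)
    (auto simp: tensor_block_apply inner_Pair scaleR_add_left)


section \<open>Limits along partitions\<close>

definition is_partition :: "real \<Rightarrow> real \<Rightarrow> real list \<Rightarrow> bool"
  where "is_partition s t xs \<longleftrightarrow> xs \<noteq> [] \<and> sorted_wrt (<) xs \<and> hd xs = s \<and> last xs = t"

definition partition_sum :: "(real \<Rightarrow> real \<Rightarrow> 'b::comm_monoid_add) \<Rightarrow> real list \<Rightarrow> 'b"
  where "partition_sum f xs = (\<Sum>i<length xs - 1. f (xs ! i) (xs ! Suc i))"

definition mesh_filter :: "real \<Rightarrow> real \<Rightarrow> real list filter"
  where "mesh_filter s t = (INF d\<in>{0<..}. principal
    {xs. is_partition s t xs \<and> (\<forall>i<length xs - 1. xs ! Suc i - xs ! i < d)})"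

lemma eventually_mesh_filter:
  "eventually Q (mesh_filter s t) \<longleftrightarrow>
    (\<exists>d>0. \<forall>xs. is_partition s t xs \<longrightarrow> (\<forall>i<length xs - 1. xs ! Suc i - xs ! i < d) \<longrightarrow> Q xs)"
  unfolding mesh_filter_def
proof (subst eventually_INF_base, goal_cases)
  case 1
  show ?case by (auto intro: exI[of _ 1])
next
  case (2 a b)
  then show ?case
    by (intro bexI[of _ "min a b"]) auto
next
  case 3
  show ?case by (auto simp: eventually_principal)
qed


section \<open>Rough paths and controlled rough paths\<close>

definition holder_on :: "real \<Rightarrow> real \<Rightarrow> (real \<Rightarrow> 'w::real_normed_vector) \<Rightarrow> bool"
  where "holder_on \<alpha> T Y \<longleftrightarrow>
    (\<exists>C. \<forall>s t. 0 \<le> s \<and> s < t \<and> t \<le> T \<longrightarrow> norm (Y t - Y s) \<le> C * (t - s) powr \<alpha>)"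

definition rough_path ::
    "real \<Rightarrow> real \<Rightarrow> (real \<Rightarrow> 'v::euclidean_space) \<Rightarrow> (real \<Rightarrow> real \<Rightarrow> 'v \<Rightarrow>\<^sub>L 'v) \<Rightarrow> bool"
  where "rough_path \<alpha> T X XX \<longleftrightarrow>
    holder_on \<alpha> T X \<and>
    (\<exists>C. \<forall>s t. 0 \<le> s \<and> s < t \<and> t \<le> T \<longrightarrow> norm (XX s t) \<le> C * (t - s) powr (2 * \<alpha>)) \<and>
    (\<forall>s u t. 0 \<le> s \<and> s < u \<and> u < t \<and> t \<le> T \<longrightarrow>
      XX s t - XX s u - XX u t = tensor (X u - X s) (X t - X u))"

definition controlled2 ::
    "real \<Rightarrow> real \<Rightarrow> (real \<Rightarrow> 'v::euclidean_space) \<Rightarrow>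
      (real \<Rightarrow> 'w::real_normed_vector) \<Rightarrow> (real \<Rightarrow> 'v \<Rightarrow>\<^sub>L 'w) \<Rightarrow> bool"
  where "controlled2 \<alpha> T X Y Y' \<longleftrightarrow>
    holder_on \<alpha> T Y' \<and>
    (\<exists>C. \<forall>s t. 0 \<le> s \<and> s < t \<and> t \<le> T \<longrightarrow>
      norm (Y t - Y s - blinfun_apply (Y' s) (X t - X s)) \<le> C * (t - s) powr (2 * \<alpha>))"

definition controlled3 ::
    "real \<Rightarrow> real \<Rightarrow> (real \<Rightarrow> 'v::euclidean_space) \<Rightarrow> (real \<Rightarrow> real \<Rightarrow> 'v \<Rightarrow>\<^sub>L 'v) \<Rightarrow>
      (real \<Rightarrow> 'w::real_normed_vector) \<Rightarrow> (real \<Rightarrow> 'v \<Rightarrow>\<^sub>L 'w) \<Rightarrow>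
      (real \<Rightarrow> 'v \<Rightarrow>\<^sub>L ('v \<Rightarrow>\<^sub>L 'w)) \<Rightarrow> (real \<Rightarrow> 'w) \<Rightarrow> bool"
  where "controlled3 \<alpha> T X XX Y Y' Y'' Yd \<longleftrightarrow>
    (\<exists>C. \<forall>s t. 0 \<le> s \<and> s < t \<and> t \<le> T \<longrightarrow>
      norm (Y t - Y s - blinfun_apply (Y' s) (X t - X s)
            - tensor_lift (\<lambda>y z. blinfun_apply (blinfun_apply (Y'' s) y) z) (XX s t)
            - (t - s) *\<^sub>R Yd s)
        \<le> C * (t - s) powr (3 * \<alpha>)) \<and>
    controlled2 \<alpha> T X Y' Y'' \<and>
    holder_on \<alpha> T Yd"

text \<open>
  The integrand takes values in the linear maps from \<open>\<real>\<^sup>m\<close> to \<open>\<real>\<^sup>n\<close>, here matrices.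
  They form a Euclidean space, as needed below for matrix-valued martingales.
\<close>

definition rough_integral ::
    "(real \<Rightarrow> real^'m) \<Rightarrow> (real \<Rightarrow> real \<Rightarrow> (real^'m) \<Rightarrow>\<^sub>L (real^'m)) \<Rightarrow>
      (real \<Rightarrow> real^'m^'n) \<Rightarrow> (real \<Rightarrow> (real^'m) \<Rightarrow>\<^sub>L (real^'m^'n)) \<Rightarrow> real \<Rightarrow> real \<Rightarrow> real^'n"
  where "rough_integral X XX Z Z' s t = Lim (mesh_filter s t)
    (partition_sum (\<lambda>u v. Z u *v (X v - X u) +
       tensor_lift (\<lambda>y z. blinfun_apply (Z' u) y *v z) (XX u v)))"


section \<open>Processes and martingales on a bounded time interval\<close>

text \<open>Processes are indexed by the reals, but only times in \<open>{0..T}\<close> matter.\<close>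

definition usual_conditions :: "'a measure \<Rightarrow> (real \<Rightarrow> 'a measure) \<Rightarrow> real \<Rightarrow> bool"
  where "usual_conditions P F T \<longleftrightarrow>
    prob_space P \<and> complete_measure P \<and>
    (\<forall>t\<in>{0..T}. subalgebra P (F t)) \<and>
    (\<forall>s\<in>{0..T}. \<forall>t\<in>{s..T}. sets (F s) \<subseteq> sets (F t)) \<and>
    null_sets P \<subseteq> sets (F 0) \<and>
    (\<forall>t\<in>{0..<T}. sets (F t) = (\<Inter>u\<in>{t<..T}. sets (F u)))"

definition adapted ::
    "(real \<Rightarrow> 'a measure) \<Rightarrow> real \<Rightarrow> (real \<Rightarrow> 'a \<Rightarrow> 'b::topological_space) \<Rightarrow> bool"
  where "adapted F T Y \<longleftrightarrow> (\<forall>t\<in>{0..T}. Y t \<in> borel_measurable (F t))"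

definition continuous_adapted ::
    "'a measure \<Rightarrow> (real \<Rightarrow> 'a measure) \<Rightarrow> real \<Rightarrow> (real \<Rightarrow> 'a \<Rightarrow> 'b::topological_space) \<Rightarrow> bool"
  where "continuous_adapted P F T Y \<longleftrightarrow>
    adapted F T Y \<and> (AE \<omega> in P. continuous_on {0..T} (\<lambda>t. Y t \<omega>))"

definition progressive ::
    "(real \<Rightarrow> 'a measure) \<Rightarrow> real \<Rightarrow> (real \<Rightarrow> 'a \<Rightarrow> 'b::topological_space) \<Rightarrow> bool"
  where "progressive F T Y \<longleftrightarrow>
    (\<forall>t\<in>{0..T}. (\<lambda>(s, \<omega>). Y s \<omega>) \<in> borel_measurable (restrict_space borel {0..t} \<Otimes>\<^sub>M F t))"

definition martingale ::
    "'a measure \<Rightarrow> (real \<Rightarrow> 'a measure) \<Rightarrow> real \<Rightarrow> (real \<Rightarrow> 'a \<Rightarrow> real) \<Rightarrow> bool"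
  where "martingale P F T L \<longleftrightarrow>
    adapted F T L \<and>
    (\<forall>t\<in>{0..T}. integrable P (L t)) \<and>
    (\<forall>s\<in>{0..T}. \<forall>t\<in>{s..T}. AE \<omega> in P. real_cond_exp P (F s) (L t) \<omega> = L s \<omega>)"

text \<open>
  A localizing sequence on \<open>{0..T}\<close> almost surely reaches \<open>T\<close> after finitely many terms; the values
  of a stopping time above \<open>T\<close> play the role of infinity.  The initial value is subtracted before
  localizing, so that it need not be integrable.
\<close>

definition continuous_local_martingale ::
    "'a measure \<Rightarrow> (real \<Rightarrow> 'a measure) \<Rightarrow> real \<Rightarrow> (real \<Rightarrow> 'a \<Rightarrow> real) \<Rightarrow> bool"
  where "continuous_local_martingale P F T L \<longleftrightarrow>
    continuous_adapted P F T L \<and>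
    (\<exists>\<tau> :: nat \<Rightarrow> 'a \<Rightarrow> real.
      (\<forall>k. \<forall>t\<in>{0..T}. Measurable.pred (F t) (\<lambda>\<omega>. \<tau> k \<omega> \<le> t)) \<and>
      (\<forall>\<omega>\<in>space P. (\<forall>k. 0 \<le> \<tau> k \<omega>) \<and> incseq (\<lambda>k. \<tau> k \<omega>)) \<and>
      (AE \<omega> in P. \<exists>k. T \<le> \<tau> k \<omega>) \<and>
      (\<forall>k. martingale P F T (\<lambda>t \<omega>. L (min t (\<tau> k \<omega>)) \<omega> - L 0 \<omega>)))"

text \<open>
  The quadratic variation of a vector-valued process is tensor-valued; its components are the
  covariations of the components of the process.
\<close>

definition quadratic_variation ::
    "'a measure \<Rightarrow> (real \<Rightarrow> 'a measure) \<Rightarrow> real \<Rightarrow> (real \<Rightarrow> 'a \<Rightarrow> 'w::euclidean_space) \<Rightarrow>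
      (real \<Rightarrow> 'a \<Rightarrow> 'w \<Rightarrow>\<^sub>L 'w) \<Rightarrow> bool"
  where "quadratic_variation P F T L Q \<longleftrightarrow>
    continuous_adapted P F T Q \<and>
    (AE \<omega> in P. Q 0 \<omega> = 0 \<and>
      (\<exists>C. \<forall>xs. is_partition 0 T xs \<longrightarrow> partition_sum (\<lambda>u v. norm (Q v \<omega> - Q u \<omega>)) xs \<le> C)) \<and>
    (\<forall>i\<in>Basis. \<forall>j\<in>Basis. continuous_local_martingale P F T
      (\<lambda>t \<omega>. (L t \<omega> \<bullet> i) * (L t \<omega> \<bullet> j) - blinfun_apply (Q t \<omega>) i \<bullet> j))"

definition local_martingale_lipschitz_qv ::
    "'a measure \<Rightarrow> (real \<Rightarrow> 'a measure) \<Rightarrow> real \<Rightarrow> (real \<Rightarrow> 'a \<Rightarrow> 'w::euclidean_space) \<Rightarrow> bool"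
  where "local_martingale_lipschitz_qv P F T L \<longleftrightarrow>
    (\<forall>i\<in>Basis. continuous_local_martingale P F T (\<lambda>t \<omega>. L t \<omega> \<bullet> i)) \<and>
    (\<exists>Q. quadratic_variation P F T L Q \<and>
      (AE \<omega> in P. \<exists>C. C-lipschitz_on {0..T} (\<lambda>t. Q t \<omega>)))"


section \<open>It\^o integrals and the joint lift\<close>

text \<open>
  For a continuous adapted integrand the It\^o integral is the continuous adapted process which at
  each time is the limit in probability of the left-point Riemann sums.  It is unique up to
  indistinguishability; \<open>ito_integral\<close> picks one version.
\<close>

definition is_ito_integral ::
    "'a measure \<Rightarrow> (real \<Rightarrow> 'a measure) \<Rightarrow> real \<Rightarrow> (real \<Rightarrow> 'a \<Rightarrow> real) \<Rightarrow> (real \<Rightarrow> 'a \<Rightarrow> real) \<Rightarrow>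
      (real \<Rightarrow> 'a \<Rightarrow> real) \<Rightarrow> bool"
  where "is_ito_integral P F T H L I \<longleftrightarrow>
    continuous_adapted P F T I \<and>
    (\<forall>t\<in>{0..T}. \<forall>\<epsilon>>0.
      ((\<lambda>xs. measure P {\<omega> \<in> space P.
          \<epsilon> < \<bar>partition_sum (\<lambda>u v. H u \<omega> * (L v \<omega> - L u \<omega>)) xs - I t \<omega>\<bar>}) \<longlongrightarrow> 0)
        (mesh_filter 0 t))"

definition ito_integral ::
    "'a measure \<Rightarrow> (real \<Rightarrow> 'a measure) \<Rightarrow> real \<Rightarrow> (real \<Rightarrow> 'a \<Rightarrow> real) \<Rightarrow> (real \<Rightarrow> 'a \<Rightarrow> real) \<Rightarrow>
      real \<Rightarrow> 'a \<Rightarrow> real"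
  where "ito_integral P F T H L = (SOME I. is_ito_integral P F T H L I)"

text \<open>The process \<open>t \<mapsto> \<integral>\<^sub>0\<^sup>t H\<^sub>r \<otimes> dL\<^sub>r\<close>, defined componentwise.\<close>

definition ito_tensor_integral ::
    "'a measure \<Rightarrow> (real \<Rightarrow> 'a measure) \<Rightarrow> real \<Rightarrow>
      (real \<Rightarrow> 'a \<Rightarrow> 'v::euclidean_space) \<Rightarrow> (real \<Rightarrow> 'a \<Rightarrow> 'w::euclidean_space) \<Rightarrow>
      real \<Rightarrow> 'a \<Rightarrow> 'v \<Rightarrow>\<^sub>L 'w"
  where "ito_tensor_integral P F T H L t \<omega> =
    (\<Sum>i\<in>Basis. \<Sum>j\<in>Basis.
      ito_integral P F T (\<lambda>r \<omega>. H r \<omega> \<bullet> i) (\<lambda>r \<omega>. L r \<omega> \<bullet> j) t \<omega> *\<^sub>R tensor i j)"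

text \<open>
  \<open>\<integral>\<^sub>s\<^sup>t \<delta>H\<^sub>s\<^sub>,\<^sub>r \<otimes> dL\<^sub>r\<close>, obtained for all \<open>s < t\<close> simultaneously from the increments of a single
  version of the integral process.
\<close>

definition ito_increment ::
    "'a measure \<Rightarrow> (real \<Rightarrow> 'a measure) \<Rightarrow> real \<Rightarrow>
      (real \<Rightarrow> 'a \<Rightarrow> 'v::euclidean_space) \<Rightarrow> (real \<Rightarrow> 'a \<Rightarrow> 'w::euclidean_space) \<Rightarrow>
      real \<Rightarrow> real \<Rightarrow> 'a \<Rightarrow> 'v \<Rightarrow>\<^sub>L 'w"
  where "ito_increment P F T H L s t \<omega> =
    ito_tensor_integral P F T H L t \<omega> - ito_tensor_integral P F T H L s \<omega>
      - tensor (H s \<omega>) (L t \<omega> - L s \<omega>)"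

definition Pi_XL ::
    "'a measure \<Rightarrow> (real \<Rightarrow> 'a measure) \<Rightarrow> real \<Rightarrow>
      (real \<Rightarrow> 'v::euclidean_space) \<Rightarrow> (real \<Rightarrow> 'a \<Rightarrow> 'w::euclidean_space) \<Rightarrow>
      real \<Rightarrow> real \<Rightarrow> 'a \<Rightarrow> 'v \<Rightarrow>\<^sub>L 'w"
  where "Pi_XL P F T X L = ito_increment P F T (\<lambda>t \<omega>. X t) L"

definition Pi_LX ::
    "'a measure \<Rightarrow> (real \<Rightarrow> 'a measure) \<Rightarrow> real \<Rightarrow>
      (real \<Rightarrow> 'a \<Rightarrow> 'w::euclidean_space) \<Rightarrow> (real \<Rightarrow> 'v::euclidean_space) \<Rightarrow>
      real \<Rightarrow> real \<Rightarrow> 'a \<Rightarrow> 'w \<Rightarrow>\<^sub>L 'v"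
  where "Pi_LX P F T L X s t \<omega> =
    tensor (L t \<omega> - L s \<omega>) (X t - X s) - tensor_transpose (Pi_XL P F T X L s t \<omega>)"

definition joint_path ::
    "(real \<Rightarrow> 'v::euclidean_space) \<Rightarrow> (real \<Rightarrow> 'a \<Rightarrow> 'w::euclidean_space) \<Rightarrow>
      'a \<Rightarrow> real \<Rightarrow> 'v \<times> 'w"
  where "joint_path X L \<omega> t = (X t, L t \<omega>)"

definition joint_lift ::
    "'a measure \<Rightarrow> (real \<Rightarrow> 'a measure) \<Rightarrow> real \<Rightarrow>
      (real \<Rightarrow> 'v::euclidean_space) \<Rightarrow> (real \<Rightarrow> real \<Rightarrow> 'v \<Rightarrow>\<^sub>L 'v) \<Rightarrow>
      (real \<Rightarrow> 'a \<Rightarrow> 'w::euclidean_space) \<Rightarrow>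
      'a \<Rightarrow> real \<Rightarrow> real \<Rightarrow> ('v \<times> 'w) \<Rightarrow>\<^sub>L ('v \<times> 'w)"
  where "joint_lift P F T X XX L \<omega> s t =
    tensor_block (XX s t) (Pi_XL P F T X L s t \<omega>)
                 (Pi_LX P F T L X s t \<omega>) (ito_increment P F T L L s t \<omega>)"


section \<open>Rough semimartingales\<close>

definition rough_semimartingale ::
    "'a measure \<Rightarrow> (real \<Rightarrow> 'a measure) \<Rightarrow> real \<Rightarrow> real \<Rightarrow> (real \<Rightarrow> 'v::euclidean_space) \<Rightarrow>
      (real \<Rightarrow> 'a \<Rightarrow> 'w::euclidean_space) \<Rightarrow> (real \<Rightarrow> 'a \<Rightarrow> 'v \<Rightarrow>\<^sub>L 'w) \<Rightarrow>
      (real \<Rightarrow> 'a \<Rightarrow> 'w) \<Rightarrow> bool"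
  where "rough_semimartingale P F T \<alpha> X Y Y' M \<longleftrightarrow>
    local_martingale_lipschitz_qv P F T M \<and>
    continuous_adapted P F T Y \<and> continuous_adapted P F T Y' \<and>
    (AE \<omega> in P. controlled2 \<alpha> T X (\<lambda>t. Y t \<omega> - M t \<omega>) (\<lambda>t. Y' t \<omega>))"

text \<open>
  \<open>\<integral>\<^sub>0\<^sup>t (Z, Z') d\<^bold>X\<close> for a matrix-valued rough semimartingale \<open>(Z, Z'; N)\<close>: the pathwise rough
  integral of \<open>(Z - N, Z')\<close> plus the contraction of \<open>\<integral>\<^sub>0\<^sup>t N\<^sub>r \<otimes> dX\<^sub>r\<close>.
\<close>

definition rsm_integral ::
    "'a measure \<Rightarrow> (real \<Rightarrow> 'a measure) \<Rightarrow> real \<Rightarrow>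
      (real \<Rightarrow> real^'m) \<Rightarrow> (real \<Rightarrow> real \<Rightarrow> (real^'m) \<Rightarrow>\<^sub>L (real^'m)) \<Rightarrow>
      (real \<Rightarrow> 'a \<Rightarrow> real^'m^'n) \<Rightarrow> (real \<Rightarrow> 'a \<Rightarrow> (real^'m) \<Rightarrow>\<^sub>L (real^'m^'n)) \<Rightarrow>
      (real \<Rightarrow> 'a \<Rightarrow> real^'m^'n) \<Rightarrow> real \<Rightarrow> 'a \<Rightarrow> real^'n"
  where "rsm_integral P F T X XX Z Z' N t \<omega> =
    rough_integral X XX (\<lambda>r. Z r \<omega> - N r \<omega>) (\<lambda>r. Z' r \<omega>) 0 t +
    tensor_lift (*v) (Pi_LX P F T N X 0 t \<omega> + tensor (N 0 \<omega>) (X t - X 0))"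

text \<open>
  \<open>DY\<close>, \<open>D2Y\<close>, \<open>Yd\<close> are the processes \<open>\<partial>\<^sub>X Y\<close>, \<open>\<partial>\<^sub>X\<^sup>2 Y\<close> (curried, \<open>D2Y y *v z\<close> being its
  value at \<open>y \<otimes> z\<close>) and the drift density.
\<close>

definition scRSM ::
    "'a measure \<Rightarrow> (real \<Rightarrow> 'a measure) \<Rightarrow> real \<Rightarrow> real \<Rightarrow>
      (real \<Rightarrow> real^'m) \<Rightarrow> (real \<Rightarrow> real \<Rightarrow> (real^'m) \<Rightarrow>\<^sub>L (real^'m)) \<Rightarrow>
      (real \<Rightarrow> 'a \<Rightarrow> real^'n) \<Rightarrow> (real \<Rightarrow> 'a \<Rightarrow> real^'m^'n) \<Rightarrow>
      (real \<Rightarrow> 'a \<Rightarrow> (real^'m) \<Rightarrow>\<^sub>L (real^'m^'n)) \<Rightarrow> (real \<Rightarrow> 'a \<Rightarrow> real^'n) \<Rightarrow>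
      (real \<Rightarrow> 'a \<Rightarrow> real^'n) \<Rightarrow> (real \<Rightarrow> 'a \<Rightarrow> real^'m^'n) \<Rightarrow> bool"
  where "scRSM P F T \<alpha> X XX Y DY D2Y Yd M N \<longleftrightarrow>
    continuous_adapted P F T Y \<and> continuous_adapted P F T DY \<and> continuous_adapted P F T D2Y \<and>
    continuous_adapted P F T M \<and> continuous_adapted P F T N \<and>
    adapted F T Yd \<and> progressive F T Yd \<and>
    (AE \<omega> in P. \<exists>C. AE t in lborel. t \<in> {0..T} \<longrightarrow> norm (Yd t \<omega>) \<le> C) \<and>
    rough_semimartingale P F T \<alpha> X DY D2Y N \<and>
    local_martingale_lipschitz_qv P F T M \<and>
    (AE \<omega> in P. \<forall>t\<in>{0..T}.
      Y t \<omega> = Y 0 \<omega> + (LINT s:{0..t}|lborel. Yd s \<omega>) + M t \<omega>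
              + rsm_integral P F T X XX DY D2Y N t \<omega>)"


section \<open>Derivatives with respect to the joint lift\<close>

definition joint_deriv ::
    "(real \<Rightarrow> 'a \<Rightarrow> real^'m^'n) \<Rightarrow>
      real \<Rightarrow> 'a \<Rightarrow> ((real^'m) \<times> (real^'n) \<times> (real^'m^'n)) \<Rightarrow>\<^sub>L (real^'n)"
  where "joint_deriv DY t \<omega> = Blinfun (\<lambda>(z1, z2, z3). DY t \<omega> *v z1 + z2)"

definition joint_deriv2 ::
    "(real \<Rightarrow> 'a \<Rightarrow> (real^'m) \<Rightarrow>\<^sub>L (real^'m^'n)) \<Rightarrow>
      real \<Rightarrow> 'a \<Rightarrow> ((real^'m) \<times> (real^'n) \<times> (real^'m^'n)) \<Rightarrow>\<^sub>L
        (((real^'m) \<times> (real^'n) \<times> (real^'m^'n)) \<Rightarrow>\<^sub>L (real^'n))"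
  where "joint_deriv2 D2Y t \<omega> =
    Blinfun (\<lambda>(y1, y2, y3). Blinfun (\<lambda>(z1, z2, z3).
      blinfun_apply (D2Y t \<omega>) y1 *v z1 + y3 *v z1))"

lemma joint_deriv_apply:
  fixes DY :: "real \<Rightarrow> 'a \<Rightarrow> real^'m^'n"
  shows "blinfun_apply (joint_deriv DY t \<omega>) (z1, z2, z3) = DY t \<omega> *v z1 + z2"
proof -
  have "bounded_linear (\<lambda>(z1, z2, z3 :: real^'m^'n). DY t \<omega> *v z1 + z2)"
    unfolding linear_conv_bounded_linear[symmetric]
    by (rule linearI) (auto simp: algebra_simps matrix_vector_right_distrib
      matrix_vector_mult_scaleR)
  then show ?thesis
    by (simp add: joint_deriv_def bounded_linear_Blinfun_apply)
qed

lemma joint_deriv2_apply: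
  fixes D2Y :: "real \<Rightarrow> 'a \<Rightarrow> (real^'m) \<Rightarrow>\<^sub>L (real^'m^'n)"
  shows "blinfun_apply (blinfun_apply (joint_deriv2 D2Y t \<omega>) (y1, y2, y3)) (z1, z2, z3) =
    blinfun_apply (D2Y t \<omega>) y1 *v z1 + y3 *v z1"
proof -
  define g :: "real^'m \<Rightarrow> real^'m^'n \<Rightarrow> (real^'m) \<times> (real^'n) \<times> (real^'m^'n) \<Rightarrow> real^'n"
    where "g = (\<lambda>y1 y3 (z1, z2, z3). blinfun_apply (D2Y t \<omega>) y1 *v z1 + y3 *v z1)"
  have g: "bounded_linear (g y1 y3)" for y1 y3
    unfolding linear_conv_bounded_linear[symmetric] g_def
    by (rule linearI) (auto simp: algebra_simps matrix_vector_right_distrib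
      matrix_vector_mult_scaleR)
  have g_apply: "blinfun_apply (Blinfun (g y1 y3)) (z1, z2, z3) =
      blinfun_apply (D2Y t \<omega>) y1 *v z1 + y3 *v z1" for y1 y3 z1 z2 z3
    by (simp add: bounded_linear_Blinfun_apply[OF g]) (simp add: g_def)
  have "bounded_linear (\<lambda>(y1, y2 :: real^'n, y3). Blinfun (g y1 y3))"
    unfolding linear_conv_bounded_linear[symmetric]
    by (rule linearI; rule blinfun_eqI)
      (auto simp: g_apply blinfun.bilinear_simps matrix_vector_mult_add_rdistrib
        scaleR_matrix_vector_assoc[symmetric] scaleR_add_right)
  moreover have "joint_deriv2 D2Y t \<omega> = Blinfun (\<lambda>(y1, y2, y3). Blinfun (g y1 y3))"
    by (simp add: joint_deriv2_def g_def)
  ultimately show ?thesis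
    by (simp add: bounded_linear_Blinfun_apply g_apply)
qed

end

theory Submission
  imports Defs
begin

text \<open>
  In \<open>\<integral>\<^sub>s\<^sup>t (\<partial>\<^sub>X Y, \<partial>\<^sub>X\<^sup>2 Y) d\<^bold>X\<close> the pathwise rough integral of \<open>(\<partial>\<^sub>X Y - N, \<partial>\<^sub>X\<^sup>2 Y)\<close> agrees up to
  \<open>|t - s|\<^bsup>3\<alpha>\<^esup>\<close> with \<open>(\<partial>\<^sub>X Y - N)\<^sub>s \<delta>X + \<partial>\<^sub>X\<^sup>2 Y\<^sub>s XX\<close> by the sewing lemma, whereas the integral of \<open>N\<close>
  against \<open>X\<close> equals \<open>N\<^sub>s \<delta>X + \<Pi>(N; X)\<close> exactly, because integration by parts is additive in time.
  The second term is the only block of the joint lift that the identity block of \<open>Y''\<close> sees,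
  and \<open>\<delta>M\<close> is matched exactly by \<open>Y'\<close>.
\<close>

section \<open>The sewing lemma\<close>

text \<open>
  Truncating the grid points at \<open>t\<close> makes the last, incomplete cell an ordinary summand; the cells
  beyond \<open>t\<close> contribute \<open>\<Xi> t t\<close>, which is \<open>0\<close> below.
\<close>

definition grid_sum :: "(real \<Rightarrow> real \<Rightarrow> 'b::comm_monoid_add) \<Rightarrow> real \<Rightarrow> nat \<Rightarrow> real \<Rightarrow> 'b"
  where "grid_sum \<Xi> h K t = (\<Sum>k<K. \<Xi> (min (real k * h) t) (min (real (Suc k) * h) t))"

text \<open>A defect exponent above 1 beats the number of cells, which grows like the inverse of the
  mesh, so successive refinements are summable. The inequalities in \<open>defect\<close> are weak
  because truncated grid points may coincide.\<close>

locale almost_additive =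
  fixes \<Xi> :: "real \<Rightarrow> real \<Rightarrow> 'b::banach" and C \<theta> T :: real
  assumes exponent: "1 < \<theta>" and horizon: "0 < T"
    and diagonal: "\<Xi> u u = 0"
    and defect: "\<lbrakk>0 \<le> s; s \<le> u; u \<le> t; t \<le> T\<rbrakk> \<Longrightarrow>
      norm (\<Xi> s u + \<Xi> u t - \<Xi> s t) \<le> C * (t - s) powr \<theta>"
begin

lemma const_nonneg: "0 \<le> C"
proof -
  have "0 \<le> C * (T - 0) powr \<theta>"
    using defect[of 0 0 T] horizon order_trans[OF norm_ge_zero] by simp
  then show ?thesis
    using horizon by (simp add: zero_le_mult_iff)
qed

lemma grid_sum_zero:
  assumes "0 < h"
  shows "grid_sum \<Xi> h K 0 = 0"
  using assms by (simp add: grid_sum_def diagonal)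

text \<open>Only the cells that meet \<open>[s, t]\<close> contribute, so the bound decays with \<open>t - s\<close>.\<close>

lemma grid_sum_refine:
  assumes h: "0 < h" and st: "0 \<le> s" "s \<le> t" "t \<le> T"
  shows "norm ((grid_sum \<Xi> (h / 2) (2 * K) t - grid_sum \<Xi> h K t)
      - (grid_sum \<Xi> (h / 2) (2 * K) s - grid_sum \<Xi> h K s))
    \<le> 2 * C * h powr \<theta> * ((t - s) / h + 2)"
proof -
  \<comment> \<open>\<open>e k r\<close> is the defect caused by inserting the midpoint into cell
    \<open>k\<close>, all points being truncated at \<open>r\<close>.\<close>
  define e where "e k r = \<Xi> (min (real k * h) r) (min (real k * h + h / 2) r)
      + \<Xi> (min (real k * h + h / 2) r) (min (real (Suc k) * h) r)
      - \<Xi> (min (real k * h) r) (min (real (Suc k) * h) r)" for k r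
  have dbl: "grid_sum \<Xi> (h / 2) (2 * K) r =
      (\<Sum>k<K. \<Xi> (min (real k * h) r) (min (real k * h + h / 2) r)
      + \<Xi> (min (real k * h + h / 2) r) (min (real (Suc k) * h) r))" for r
    unfolding grid_sum_def
    by (induction K) (auto simp: add_divide_distrib algebra_simps)
  have diff: "grid_sum \<Xi> (h / 2) (2 * K) r - grid_sum \<Xi> h K r = (\<Sum>k<K. e k r)" for r
    unfolding dbl by (simp add: grid_sum_def e_def sum_subtractf)
  have e_le: "norm (e k r) \<le> C * h powr \<theta>" if "0 \<le> r" "r \<le> T" for k r
  proof -
    have "norm (e k r) \<le> C * (min (real (Suc k) * h) r - min (real k * h) r) powr \<theta>"
      unfolding e_def using that h by (intro defect) (auto simp: min_def field_simps)
    also have "\<dots> \<le> C * h powr \<theta>"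
      using exponent h
      by (intro mult_left_mono const_nonneg powr_mono2) (auto simp: min_def field_simps)
    finally show ?thesis .
  qed
  \<comment> \<open>A cell with index outside \<open>A\<close> ends before \<open>s\<close>, where
    truncation at \<open>s\<close> and at \<open>t\<close> has the same effect, or starts after
    \<open>t\<close>, where both truncations collapse it to the diagonal. Rounding outwards at both
    ends accounts for the 2 in the cardinality bound.\<close>
  define A where "A = {nat \<lfloor>s / h\<rfloor>..<nat \<lceil>t / h\<rceil>}"
  have e_eq: "e k t - e k s = 0" if "k \<notin> A" for k
  proof -
    have "real (Suc k) * h \<le> s \<or> t \<le> real k * h"
    proof -
      from that have "int k < \<lfloor>s / h\<rfloor> \<or> t / h \<le> real k"
        by (auto simp: A_def nat_ceiling_le_eq not_less)
      then have "real (Suc k) \<le> s / h \<or> t / h \<le> real k"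
        by linarith
      then show ?thesis
        using h by (simp only: pos_le_divide_eq pos_divide_le_eq)
    qed
    then show ?thesis
    proof
      assume 1: "real (Suc k) * h \<le> s"
      then have "real k * h + h / 2 \<le> s" "real k * h \<le> s"
        using h by (auto simp: field_simps)
      with 1 show ?thesis
        using st by (simp add: e_def min_absorb1)
    next
      assume 2: "t \<le> real k * h"
      then have "t \<le> real k * h + h / 2" "t \<le> real (Suc k) * h"
        using h by (auto simp: field_simps)
      with 2 show ?thesis
        using st by (simp add: e_def min_absorb2 diagonal)
    qed
  qed
  have cardA: "real (card A) \<le> (t - s) / h + 2"
  proof -
    have "0 \<le> s / h" "s / h \<le> t / h"
      using st h by (auto simp: divide_right_mono)
    then show ?thesis
      unfolding A_def card_atLeastLessThan diff_divide_distrib by linarith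
  qed
  have "norm (\<Sum>k<K. e k t - e k s) = norm (\<Sum>k\<in>{..<K} \<inter> A. e k t - e k s)"
    by (rule arg_cong[where f = norm], rule sum.mono_neutral_right) (auto simp: e_eq)
  \<comment> \<open>Each index costs two defects, one truncated at \<open>t\<close> and one at
    \<open>s\<close>.\<close>
  also have "\<dots> \<le> (\<Sum>k\<in>{..<K} \<inter> A. C * h powr \<theta> + C * h powr \<theta>)"
    using st by (intro sum_norm_le order_trans[OF norm_triangle_ineq4] add_mono e_le) auto
  also have "\<dots> \<le> (\<Sum>k\<in>A. 2 * C * h powr \<theta>)"
    by (simp only: mult_2 distrib_right) (intro sum_mono2, auto simp: A_def const_nonneg)
  also have "\<dots> \<le> 2 * C * h powr \<theta> * ((t - s) / h + 2)"
    using mult_left_mono[OF cardA, of "2 * C * h powr \<theta>"] const_nonneg by (simp add: mult.commute)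
  finally show ?thesis
    by (simp add: diff sum_subtractf)
qed

text \<open>If the mesh is at least \<open>t - s\<close>, only the cell containing \<open>s\<close>
  and its successor contribute to the increment. The resulting combination of at most three germ
  values differs from \<open>\<Xi> s t\<close> by the defect of \<open>s \<le> b \<le> t\<close> and
  that of \<open>a \<le> s \<le> b\<close>.\<close>

lemma grid_sum_coarse:
  assumes h: "0 < h" "T \<le> real K * h" and st: "0 \<le> s" "s < t" "t \<le> T" "t - s \<le> h"
  shows "norm (grid_sum \<Xi> h K t - grid_sum \<Xi> h K s - \<Xi> s t) \<le> C * (2 * h) powr \<theta> + C * h powr \<theta>"
proof -
  define j where "j = nat \<lfloor>s / h\<rfloor>"
  have js: "real j * h \<le> s" "s < real (Suc j) * h"
  proof -
    have "0 \<le> s / h" using st h by auto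
    then have "real j \<le> s / h" "s / h < real (Suc j)" unfolding j_def by linarith+
    then show "real j * h \<le> s" "s < real (Suc j) * h" using h by (auto simp: field_simps)
  qed
  have jt: "t \<le> real (Suc (Suc j)) * h"
    using js st by (auto simp: field_simps)
  have jK: "j < K"
  proof -
    have "real j * h < real K * h" using js st h by linarith
    then show ?thesis using h by simp
  qed
  \<comment> \<open>\<open>a\<close> is the left end of the cell containing \<open>s\<close>, and
    \<open>b\<close> is its right end truncated at \<open>t\<close>.\<close>
  define a b where "a = real j * h" and "b = min (real (Suc j) * h) t"
  have ab: "0 \<le> a" "a \<le> s" "s \<le> b" "b \<le> t" "b - a \<le> h" "t - a \<le> 2 * h"
    using js st h jt by (auto simp: a_def b_def field_simps)
  define d where "d k = \<Xi> (min (real k * h) t) (min (real (Suc k) * h) t)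
    - \<Xi> (min (real k * h) s) (min (real (Suc k) * h) s)" for k
  have d_low: "d k = 0" if "k < j" for k
  proof -
    have "real (Suc k) * h \<le> real j * h" using that h by (intro mult_right_mono) auto
    moreover have "real k * h \<le> real (Suc k) * h" using h by (intro mult_right_mono) auto
    ultimately have "real (Suc k) * h \<le> s" "real k * h \<le> s" using js by linarith+
    then show ?thesis using st by (simp add: d_def min_absorb1)
  qed
  have d_high: "d k = 0" if "Suc (Suc j) \<le> k" for k
  proof -
    have "real (Suc (Suc j)) * h \<le> real k * h" using that h by (intro mult_right_mono) auto
    moreover have "real k * h \<le> real (Suc k) * h" using h by (intro mult_right_mono) auto
    ultimately have "t \<le> real k * h" "t \<le> real (Suc k) * h" using jt by linarith+
    then show ?thesis using st by (simp add: d_def min_absorb2 diagonal)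
  qed
  have d_j: "d j = \<Xi> a b - \<Xi> a s"
    using js st by (simp add: d_def a_def b_def min_absorb1 min_absorb2)
  have d_Suc: "d (Suc j) = \<Xi> b t"
    unfolding d_def using js jt st by (simp add: b_def min_absorb2 diagonal del: of_nat_Suc)
  \<comment> \<open>If \<open>j\<close> is the last index, cell \<open>Suc j\<close> is absent from
    the sum. Then the grid ends at or beyond \<open>T\<close>, so \<open>b = t\<close> and the
    missing summand is \<open>\<Xi> t t = 0\<close>; the two cases can be treated alike.\<close>
  have d_K: "d (Suc j) = 0" if "Suc j = K"
    unfolding d_Suc using that h st by (simp add: b_def min_absorb2 diagonal)
  have "(\<Sum>k<K. d k) = (\<Sum>k\<in>{j, Suc j} \<inter> {..<K}. d k)"
  proof (rule sum.mono_neutral_right; clarsimp)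
    fix i assume "i \<noteq> j" "i \<noteq> Suc j"
    then show "d i = 0" using d_low[of i] d_high[of i] by linarith
  qed
  also have "\<dots> = (\<Sum>k\<in>{j, Suc j}. d k)"
    using jK d_K by (cases "Suc j = K"; intro sum.mono_neutral_left) auto
  also have "\<dots> = \<Xi> a b - \<Xi> a s + \<Xi> b t"
    by (simp add: d_j d_Suc)
  finally have sum_d: "grid_sum \<Xi> h K t - grid_sum \<Xi> h K s = \<Xi> a b - \<Xi> a s + \<Xi> b t"
    by (simp add: grid_sum_def d_def sum_subtractf)
  have "grid_sum \<Xi> h K t - grid_sum \<Xi> h K s - \<Xi> s t =
      (\<Xi> s b + \<Xi> b t - \<Xi> s t) - (\<Xi> a s + \<Xi> s b - \<Xi> a b)"
    by (simp add: sum_d)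
  also have "norm \<dots> \<le> C * (t - s) powr \<theta> + C * (b - a) powr \<theta>"
    using ab st by (intro order_trans[OF norm_triangle_ineq4] add_mono defect) auto
  also have "\<dots> \<le> C * (2 * h) powr \<theta> + C * h powr \<theta>"
    using ab st exponent by (intro add_mono mult_left_mono powr_mono2 const_nonneg) auto
  finally show ?thesis .
qed

text \<open>
  The limit \<open>I\<close> of the dyadic grid sums is compared with \<open>\<Xi> s t\<close> starting from the level whose mesh is
  comparable to \<open>t - s\<close>; the refinements from there on are dominated by a geometric series.
\<close>

lemma sewing:
  "\<exists>I K. \<forall>s t. 0 \<le> s \<and> s < t \<and> t \<le> T \<longrightarrow> norm (I t - I s - \<Xi> s t) \<le> K * (t - s) powr \<theta>"
proof -
  define h where "h n = T / 2 ^ n" for n :: nat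
  define J where "J n = grid_sum \<Xi> (h n) (2 ^ n)" for n
  \<comment> \<open>Halving the mesh multiplies \<open>h powr (\<theta> - 1)\<close> by
    \<open>q\<close>, the ratio of the geometric series.\<close>
  define q where "q = 2 powr (1 - \<theta>)"
  have q: "0 < q" "q < 1"
    using exponent by (simp_all add: q_def powr_less_one)
  have h_pos: "0 < h n" for n
    using horizon by (simp add: h_def)
  have h_add: "h (n + m) powr (\<theta> - 1) = h n powr (\<theta> - 1) * q ^ m" for n m
  proof -
    have "(2::real) ^ m = 2 powr real m"
      by (simp add: powr_realpow)
    then have "h (n + m) = h n * 2 powr (- real m)"
      by (simp add: h_def power_add powr_minus field_simps)
    moreover have "(2 powr (- real m)) powr (\<theta> - 1) = q ^ m"
      by (simp add: q_def powr_powr powr_realpow[symmetric] algebra_simps)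
    ultimately show ?thesis
      using h_pos[of n] by (simp add: powr_mult)
  qed
  have step: "norm ((J (Suc (n + m)) t - J (Suc (n + m)) s) - (J (n + m) t - J (n + m) s))
      \<le> 6 * C * h n powr \<theta> * q ^ m" if st: "0 \<le> s" "s \<le> t" "t \<le> T" "t - s \<le> h n" for s t n m
  proof -
    have "norm ((J (Suc (n + m)) t - J (Suc (n + m)) s) - (J (n + m) t - J (n + m) s))
        \<le> 2 * C * h (n + m) powr \<theta> * ((t - s) / h (n + m) + 2)"
      using grid_sum_refine[OF h_pos[of "n + m"] st(1-3), of "2 ^ (n + m)"]
      by (simp add: J_def h_def algebra_simps)
    also have "\<dots> = 2 * C * h (n + m) powr (\<theta> - 1) * ((t - s) + 2 * h (n + m))"
      using h_pos[of "n + m"] by (simp add: powr_diff field_simps)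
    \<comment> \<open>Both \<open>t - s\<close> and the finer mesh are at most \<open>h n\<close>,
      which gives the factor 3.\<close>
    also have "\<dots> \<le> 2 * C * h (n + m) powr (\<theta> - 1) * (3 * h n)"
    proof -
      have "h (n + m) \<le> h n"
        using horizon by (simp add: h_def frac_le)
      then show ?thesis
        using st const_nonneg by (intro mult_left_mono) auto
    qed
    also have "\<dots> = 6 * C * h n powr \<theta> * q ^ m"
      unfolding h_add using h_pos[of n] by (simp add: powr_diff field_simps)
    finally show ?thesis .
  qed
  have conv: "convergent (\<lambda>n. J n t)" if t: "0 \<le> t" "t \<le> T" for t
  proof -
    \<comment> \<open>All grid sums vanish at 0, so the increment bound on \<open>[0, t]\<close> at
      level 0, where the mesh is \<open>T\<close>, bounds the refinements of \<open>J n t\<close>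
      itself.\<close>
    have J0: "J n 0 = 0" for n
      by (simp add: J_def grid_sum_zero h_pos)
    have "summable (\<lambda>m. 6 * C * h 0 powr \<theta> * q ^ m)"
      using q by (intro summable_mult summable_geometric) simp
    moreover have "norm (J (Suc m) t - J m t) \<le> 6 * C * h 0 powr \<theta> * q ^ m" for m
      using step[of 0 t 0 m] t by (simp add: J0 h_def)
    ultimately have "summable (\<lambda>m. J (Suc m) t - J m t)"
      by (rule summable_comparison_test'[where N = 0])
    then have "convergent (\<lambda>n. \<Sum>m<n. J (Suc m) t - J m t)"
      by (simp add: summable_iff_convergent)
    then have "convergent (\<lambda>n. J n t - J 0 t)"
      using sum_lessThan_telescope[of "\<lambda>m. J m t"] by simp
    then show ?thesis
      by (simp only: convergent_diff_const_right_iff)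
  qed
  define I where "I t = lim (\<lambda>n. J n t)" for t
  have lim: "(\<lambda>n. J n t) \<longlonglongrightarrow> I t" if "0 \<le> t" "t \<le> T" for t
    using conv[OF that] by (simp add: I_def convergent_LIMSEQ_iff)
  \<comment> \<open>The first two summands come from the coarse comparison, the third from the
    geometric series; the factor \<open>2 powr \<theta>\<close> pays for replacing
    \<open>h n\<close> by \<open>2 * (t - s)\<close>.\<close>
  define K where "K = (C * 2 powr \<theta> + C + 6 * C / (1 - q)) * 2 powr \<theta>"
  have "norm (I t - I s - \<Xi> s t) \<le> K * (t - s) powr \<theta>" if st: "0 \<le> s" "s < t" "t \<le> T" for s t
  proof -
    have "\<exists>n. h n < t - s"
    proof -
      obtain n where "T / (t - s) < 2 ^ n"
        using real_arch_pow[of 2] by auto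
      then show ?thesis
        using st by (auto simp: h_def field_simps intro!: exI[of _ n])
    qed
    moreover have "\<not> h 0 < t - s"
      using st by (simp add: h_def)
    \<comment> \<open>This is the last level whose mesh is not below \<open>t - s\<close>; its mesh
      is therefore less than \<open>2 * (t - s)\<close>.\<close>
    ultimately obtain n where n: "\<not> h n < t - s" "h (Suc n) < t - s"
      using ex_least_nat_less[of "\<lambda>n. h n < t - s"] by (meson lessI order_refl)
    then have n2: "t - s \<le> h n" "h n \<le> 2 * (t - s)"
      by (auto simp: h_def)
    define D where "D m = J (n + m) t - J (n + m) s" for m
    have "norm (D m - D 0) \<le> 6 * C * h n powr \<theta> / (1 - q)" for m
    proof -
      have "norm (D m - D 0) \<le> (\<Sum>i<m. norm (D (Suc i) - D i))"
        using norm_sum[of "\<lambda>i. D (Suc i) - D i" "{..<m}"] by (simp only: sum_lessThan_telescope)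
      also have "\<dots> \<le> (\<Sum>i<m. 6 * C * h n powr \<theta> * q ^ i)"
        using st n2 by (intro sum_mono) (auto simp: D_def intro!: step)
      also have "\<dots> = 6 * C * h n powr \<theta> * (\<Sum>i<m. q ^ i)"
        by (simp add: sum_distrib_left)
      also have "(\<Sum>i<m. q ^ i) \<le> 1 / (1 - q)"
        using q sum_le_suminf[of "\<lambda>i. q ^ i" "{..<m}"] by (simp add: suminf_geometric summable_geometric)
      finally show ?thesis
        using const_nonneg by (simp add: mult_left_mono)
    qed
    moreover have "(\<lambda>m. D m - D 0) \<longlonglongrightarrow> (I t - I s) - D 0"
    proof -
      have "(\<lambda>m. J (m + n) r) \<longlonglongrightarrow> I r" if "r \<in> {s, t}" for r
        using st that by (intro LIMSEQ_ignore_initial_segment lim) auto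
      then show ?thesis
        unfolding D_def by (intro tendsto_diff tendsto_const) (simp_all add: add.commute)
    qed
    ultimately have "norm ((I t - I s) - D 0) \<le> 6 * C * h n powr \<theta> / (1 - q)"
      by (intro Lim_norm_ubound[OF sequentially_bot]) auto
    moreover have "norm (D 0 - \<Xi> s t) \<le> C * (2 * h n) powr \<theta> + C * h n powr \<theta>"
      unfolding D_def J_def add_0_right using st n2 h_pos[of n]
      by (intro grid_sum_coarse) (simp_all add: h_def)
    ultimately have "norm (I t - I s - \<Xi> s t)
        \<le> 6 * C * h n powr \<theta> / (1 - q) + (C * (2 * h n) powr \<theta> + C * h n powr \<theta>)"
      using norm_triangle_le[of "(I t - I s) - D 0" "D 0 - \<Xi> s t"] by simp
    also have "\<dots> = (C * 2 powr \<theta> + C + 6 * C / (1 - q)) * h n powr \<theta>"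
      using h_pos[of n] by (simp add: powr_mult algebra_simps)
    also have "\<dots> \<le> (C * 2 powr \<theta> + C + 6 * C / (1 - q)) * (2 * (t - s)) powr \<theta>"
      using n2 h_pos[of n] q const_nonneg exponent
      by (intro mult_left_mono powr_mono2 add_nonneg_nonneg divide_nonneg_nonneg) auto
    also have "\<dots> = K * (t - s) powr \<theta>"
      unfolding K_def using st powr_mult[of 2 "t - s" \<theta>] by simp
    finally show ?thesis .
  qed
  then show ?thesis by blast
qed

end

section \<open>Partitions and convergence of their sums as the mesh vanishes\<close>

lemma partition_nth_in:
  assumes "is_partition s t xs" "i < length xs"
  shows "s \<le> xs ! i" "xs ! i \<le> t"
proof -
  have sorted: "sorted xs" and ne: "xs \<noteq> []" and s: "xs ! 0 = s" and t: "xs ! (length xs - 1) = t"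
    using assms(1) by (auto simp: is_partition_def strict_sorted_iff hd_conv_nth last_conv_nth)
  show "s \<le> xs ! i"
    using sorted_nth_mono[OF sorted, of 0 i] assms(2) s by simp
  show "xs ! i \<le> t"
    using sorted_nth_mono[OF sorted, of i "length xs - 1"] assms(2) t ne by auto
qed

lemma partition_nth_less:
  assumes "is_partition s t xs" "i < length xs - 1"
  shows "xs ! i < xs ! Suc i"
  using assms by (auto simp: is_partition_def sorted_wrt_iff_nth_less)

lemma partition_sum_telescope:
  fixes f :: "real \<Rightarrow> 'b::ab_group_add"
  assumes "is_partition s t xs"
  shows "partition_sum (\<lambda>u v. f v - f u) xs = f t - f s"
  using assms sum_lessThan_telescope[of "\<lambda>i. f (xs ! i)" "length xs - 1"]
  by (auto simp: partition_sum_def is_partition_def hd_conv_nth last_conv_nth)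

text \<open>Uniform partitions serve for \<open>s < t\<close>. For \<open>s = t\<close> the only
  partition is a single point, with no cells to check.\<close>

lemma fine_partition_exists:
  assumes "s \<le> t" "0 < d"
  shows "\<exists>xs. is_partition s t xs \<and> (\<forall>i<length xs - 1. xs ! Suc i - xs ! i < d)"
proof (cases "s < t")
  case True
  obtain n where n: "(t - s) / d < real n"
    using reals_Archimedean2 by blast
  then have n0: "0 < n"
    using True assms(2) by (intro Nat.gr0I) (auto simp: divide_less_0_iff)
  define xs where "xs = map (\<lambda>i. s + (t - s) * real i / real n) [0..<Suc n]"
  have nth: "xs ! i = s + (t - s) * real i / real n" if "i \<le> n" for i
    using that unfolding xs_def by (subst nth_map) (auto simp del: upt_Suc)
  have len: "length xs = Suc n"
    by (simp add: xs_def)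
  have "xs ! i < xs ! j" if "i < j" "j < length xs" for i j
    using that nth[of i] nth[of j] True n0 by (simp add: len divide_strict_right_mono)
  moreover have "hd xs = s" "last xs = t" "xs \<noteq> []"
  proof -
    have "xs \<noteq> []" using len by auto
    then show "hd xs = s" "last xs = t" "xs \<noteq> []"
      using n0 nth[of 0] nth[of n] by (simp_all add: hd_conv_nth last_conv_nth len)
  qed
  ultimately have "is_partition s t xs"
    by (simp add: is_partition_def sorted_wrt_iff_nth_less)
  moreover have "xs ! Suc i - xs ! i < d" if "i < length xs - 1" for i
  proof -
    have "xs ! Suc i - xs ! i = (t - s) / n"
      using that nth[of i] nth[of "Suc i"] n0 by (simp add: len field_simps)
    moreover have "(t - s) / n < d"
      using n n0 assms(2) by (simp add: field_simps)
    ultimately show ?thesis by simp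
  qed
  ultimately show ?thesis by blast
next
  case False
  with assms have "is_partition s t [s]"
    by (simp add: is_partition_def)
  then show ?thesis
    by (intro exI[of _ "[s]"]) simp
qed

text \<open>Limits along the filter are unique only if it is proper; this lets a convergence
  statement determine the value of \<open>Lim\<close>.\<close>

lemma mesh_filter_neq_bot:
  assumes "s \<le> t"
  shows "mesh_filter s t \<noteq> bot"
  using fine_partition_exists[OF assms]
  unfolding trivial_limit_def eventually_mesh_filter by auto

text \<open>The increments of \<open>I\<close> telescope along every partition, so the error is a
  sum of terms of order \<open>(v - u) powr \<theta>\<close>, hence at most a constant times the
  mesh to the power \<open>\<theta> - 1\<close>. Convergence thus holds along arbitrary partitions,
  although \<open>I\<close> may have been built from dyadic ones.\<close>

lemma partition_sum_tendsto:
  fixes \<Xi> :: "real \<Rightarrow> real \<Rightarrow> 'b::real_normed_vector"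
  assumes \<theta>: "1 < \<theta>" and "s \<le> t"
    and I: "\<And>u v. \<lbrakk>s \<le> u; u < v; v \<le> t\<rbrakk> \<Longrightarrow> norm (I v - I u - \<Xi> u v) \<le> K * (v - u) powr \<theta>"
  shows "(partition_sum \<Xi> \<longlongrightarrow> I t - I s) (mesh_filter s t)"
  unfolding tendsto_iff eventually_mesh_filter
proof (intro allI impI)
  fix e :: real assume e: "0 < e"
  \<comment> \<open>\<open>L\<close> strictly exceeds \<open>\<bar>K\<bar> * (t - s)\<close>, and
    the added ones keep it positive even if \<open>K = 0\<close> or \<open>s = t\<close>. The mesh
    bound \<open>d\<close> is then the solution of
    \<open>d powr (\<theta> - 1) = e / L\<close>.\<close>
  define L where "L = (\<bar>K\<bar> + 1) * (t - s + 1)"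
  have L: "0 < L" using \<open>s \<le> t\<close> by (simp add: L_def)
  define d where "d = (e / L) powr (1 / (\<theta> - 1))"
  have d: "0 < d" "d powr (\<theta> - 1) = e / L"
    using e L \<theta> by (auto simp: d_def powr_powr)
  have "dist (partition_sum \<Xi> xs) (I t - I s) < e"
    if xs: "is_partition s t xs" and mesh: "\<forall>i<length xs - 1. xs ! Suc i - xs ! i < d" for xs
  proof -
    have term_le: "norm (I (xs ! Suc i) - I (xs ! i) - \<Xi> (xs ! i) (xs ! Suc i))
        \<le> \<bar>K\<bar> * (e / L) * (xs ! Suc i - xs ! i)" if i: "i < length xs - 1" for i
    proof -
      define \<delta> where "\<delta> = xs ! Suc i - xs ! i"
      have \<delta>: "0 < \<delta>" "\<delta> < d"
        using partition_nth_less[OF xs i] mesh i by (auto simp: \<delta>_def)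
      have "norm (I (xs ! Suc i) - I (xs ! i) - \<Xi> (xs ! i) (xs ! Suc i)) \<le> K * \<delta> powr \<theta>"
        unfolding \<delta>_def using partition_nth_in[OF xs] partition_nth_less[OF xs i] i
        by (intro I) auto
      also have "\<dots> \<le> \<bar>K\<bar> * \<delta> powr \<theta>"
        by (intro mult_right_mono) auto
      \<comment> \<open>One power of the cell length is kept, as the lengths add up to
        \<open>t - s\<close>; the rest is controlled by the mesh.\<close>
      also have "\<delta> powr \<theta> = \<delta> powr (\<theta> - 1) * \<delta>"
        using \<delta> by (simp add: powr_diff)
      also have "\<delta> powr (\<theta> - 1) \<le> e / L"
        unfolding d(2)[symmetric] using \<delta> \<theta> by (intro powr_mono2) auto
      finally show ?thesis
        using \<delta> by (simp add: \<delta>_def mult_left_mono mult_right_mono mult.assoc)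
    qed
    have "norm (I t - I s - partition_sum \<Xi> xs) =
        norm (\<Sum>i<length xs - 1. I (xs ! Suc i) - I (xs ! i) - \<Xi> (xs ! i) (xs ! Suc i))"
      unfolding partition_sum_telescope[OF xs, symmetric] by (simp add: partition_sum_def sum_subtractf)
    also have "\<dots> \<le> (\<Sum>i<length xs - 1. \<bar>K\<bar> * (e / L) * (xs ! Suc i - xs ! i))"
      by (intro sum_norm_le term_le) (simp only: lessThan_iff)
    also have "\<dots> = \<bar>K\<bar> * (e / L) * (t - s)"
      using partition_sum_telescope[OF xs, of "\<lambda>u. u"]
      by (simp only: partition_sum_def sum_distrib_left[symmetric])
    also have "\<dots> < e"
    proof -
      have "\<bar>K\<bar> * (t - s) < L"
        using \<open>s \<le> t\<close> by (simp add: L_def algebra_simps)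
      then show ?thesis
        using mult_strict_left_mono[of "\<bar>K\<bar> * (t - s)" L e] e L by (simp add: field_simps)
    qed
    finally show ?thesis
      by (simp add: dist_norm norm_minus_commute)
  qed
  with d(1) show "\<exists>d>0. \<forall>xs. is_partition s t xs \<longrightarrow> (\<forall>i<length xs - 1. xs ! Suc i - xs ! i < d) \<longrightarrow>
      dist (partition_sum \<Xi> xs) (I t - I s) < e"
    by blast
qed

section \<open>Rough integrals\<close>

lemma bounded_bilinear_matrix_vector_mult:
  "bounded_bilinear ((*v) :: real^'m^'n \<Rightarrow> real^'m \<Rightarrow> real^'n)"
  unfolding bilinear_conv_bounded_bilinear[symmetric] bilinear_def
  by (auto intro!: linearI simp: matrix_vector_right_distrib matrix_vector_mult_add_rdistrib
    matrix_vector_mult_scaleR scaleR_matrix_vector_assoc)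

lemma norm_matrix_vector_mult_bound:
  "\<exists>b>0. \<forall>(A :: real^'m^'n) (x :: real^'m). norm (A *v x) \<le> b * norm A * norm x"
  using bounded_bilinear.pos_bounded[OF bounded_bilinear_matrix_vector_mult]
  by (metis mult.commute mult.left_commute)

lemma bounded_bilinear_blinfun_matrix_vector_mult:
  fixes A :: "'v::real_normed_vector \<Rightarrow>\<^sub>L (real^'m^'n)"
  shows "bounded_bilinear (\<lambda>y z. blinfun_apply A y *v z)"
  by (rule bounded_bilinear.comp1[OF bounded_bilinear_matrix_vector_mult blinfun.bounded_linear_right])

lemma tensor_lift_add:
  assumes "bounded_bilinear B"
  shows "tensor_lift B (S + S') = tensor_lift B S + tensor_lift B S'"
  by (simp add: tensor_lift_def blinfun.add_left bounded_bilinear.add_right[OF assms] sum.distrib)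

lemma tensor_lift_diff:
  assumes "bounded_bilinear B"
  shows "tensor_lift B (S - S') = tensor_lift B S - tensor_lift B S'"
  by (simp add: tensor_lift_def blinfun.diff_left bounded_bilinear.diff_right[OF assms] sum_subtractf)

text \<open>The norm of \<open>S\<close> is the operator norm, so each basis vector contributes at
  most \<open>b * norm S\<close>; the dimension counts the summands.\<close>

lemma norm_tensor_lift_le:
  fixes S :: "'v::euclidean_space \<Rightarrow>\<^sub>L 'w::euclidean_space"
    and B :: "'v \<Rightarrow> 'w \<Rightarrow> 'u::real_normed_vector"
  assumes B: "\<And>y z. norm (B y z) \<le> b * norm y * norm z" and "0 \<le> b"
  shows "norm (tensor_lift B S) \<le> real DIM('v) * b * norm S"
proof -
  have "norm (tensor_lift B S) \<le> (\<Sum>i\<in>(Basis :: 'v set). b * norm S)"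
    unfolding tensor_lift_def
  proof (rule sum_norm_le)
    fix i :: 'v assume i: "i \<in> Basis"
    have "norm (B i (blinfun_apply S i)) \<le> b * norm (blinfun_apply S i)"
      using B[of i "blinfun_apply S i"] i by simp
    also have "\<dots> \<le> b * norm S"
      using norm_blinfun[of S i] i \<open>0 \<le> b\<close> by (intro mult_left_mono) auto
    finally show "norm (B i (blinfun_apply S i)) \<le> b * norm S" .
  qed
  then show ?thesis by simp
qed

text \<open>\<open>holder_on\<close> leaves the sign of its constant open; the absolute value is a
  constant that can be used as a factor in monotone estimates.\<close>

lemma holder_on_nonneg:
  assumes "holder_on \<alpha> T Y"
  obtains C where "0 \<le> C"
    "\<And>s t. \<lbrakk>0 \<le> s; s < t; t \<le> T\<rbrakk> \<Longrightarrow> norm (Y t - Y s) \<le> C * (t - s) powr \<alpha>"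
proof -
  obtain C where C: "\<And>s t. \<lbrakk>0 \<le> s; s < t; t \<le> T\<rbrakk> \<Longrightarrow> norm (Y t - Y s) \<le> C * (t - s) powr \<alpha>"
    using assms by (auto simp: holder_on_def)
  show ?thesis
  proof (rule that[of "\<bar>C\<bar>"])
    fix s t assume "0 \<le> s" "s < t" "t \<le> T"
    then show "norm (Y t - Y s) \<le> \<bar>C\<bar> * (t - s) powr \<alpha>"
      using C[of s t] by (meson abs_ge_self mult_right_mono order_trans powr_ge_zero)
  qed simp
qed

section \<open>Compensated Riemann summands and the local expansion of the rough integral\<close>

definition rough_germ ::
    "(real \<Rightarrow> real^'m) \<Rightarrow> (real \<Rightarrow> real \<Rightarrow> (real^'m) \<Rightarrow>\<^sub>L (real^'m)) \<Rightarrow>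
      (real \<Rightarrow> real^'m^'n) \<Rightarrow> (real \<Rightarrow> (real^'m) \<Rightarrow>\<^sub>L (real^'m^'n)) \<Rightarrow> real \<Rightarrow> real \<Rightarrow> real^'n"
  where "rough_germ X XX Z Z' u v =
    Z u *v (X v - X u) + tensor_lift (\<lambda>y z. blinfun_apply (Z' u) y *v z) (XX u v)"

text \<open>By Chen's relation the defect is the remainder of \<open>Z\<close> on
  \<open>[s, u]\<close> applied to \<open>X t - X u\<close>, plus the increment of \<open>Z'\<close>
  on \<open>[s, u]\<close> applied to \<open>XX u t\<close>. The orders are 2\<alpha> + \<alpha> and
  \<alpha> + 2\<alpha>.\<close>

lemma rough_germ_defect:
  fixes Z :: "real \<Rightarrow> real^'m^'n"
  assumes \<alpha>: "0 < \<alpha>" and X: "rough_path \<alpha> T X XX" and Z: "controlled2 \<alpha> T X Z Z'"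
  shows "\<exists>C\<ge>0. \<forall>s u t. 0 \<le> s \<and> s < u \<and> u < t \<and> t \<le> T \<longrightarrow>
    norm (rough_germ X XX Z Z' s u + rough_germ X XX Z Z' u t - rough_germ X XX Z Z' s t)
      \<le> C * (t - s) powr (3 * \<alpha>)"
proof -
  obtain b where b: "0 < b" "\<And>(A :: real^'m^'n) (x :: real^'m). norm (A *v x) \<le> b * norm A * norm x"
    using norm_matrix_vector_mult_bound by blast
  obtain c1 where c1: "0 \<le> c1" "\<And>s t. \<lbrakk>0 \<le> s; s < t; t \<le> T\<rbrakk> \<Longrightarrow> norm (X t - X s) \<le> c1 * (t - s) powr \<alpha>"
    using X holder_on_nonneg unfolding rough_path_def by blast
  obtain c2 where c2: "0 \<le> c2" "\<And>s t. \<lbrakk>0 \<le> s; s < t; t \<le> T\<rbrakk> \<Longrightarrow> norm (Z' t - Z' s) \<le> c2 * (t - s) powr \<alpha>"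
    using Z holder_on_nonneg unfolding controlled2_def by blast
  obtain c3 where c3: "\<And>s t. \<lbrakk>0 \<le> s; s < t; t \<le> T\<rbrakk> \<Longrightarrow> norm (XX s t) \<le> c3 * (t - s) powr (2 * \<alpha>)"
    using X unfolding rough_path_def by blast
  obtain c4 where c4: "\<And>s t. \<lbrakk>0 \<le> s; s < t; t \<le> T\<rbrakk> \<Longrightarrow>
      norm (Z t - Z s - blinfun_apply (Z' s) (X t - X s)) \<le> c4 * (t - s) powr (2 * \<alpha>)"
    using Z unfolding controlled2_def by blast
  define D where "D = real DIM(real^'m)"
  \<comment> \<open>One summand for each term of the defect: \<open>b\<close> bounds the
    matrix-vector product and \<open>D\<close> is the dimension factor from
    \<open>norm_tensor_lift_le\<close>.\<close>
  define C where "C = b * \<bar>c4\<bar> * c1 + D * (b * c2) * \<bar>c3\<bar>"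
  let ?\<Xi> = "rough_germ X XX Z Z'"
  show ?thesis
  proof (intro exI[of _ C] conjI allI impI)
    show "0 \<le> C"
      using b c1 c2 by (simp add: C_def D_def)
    fix s u t assume "0 \<le> s \<and> s < u \<and> u < t \<and> t \<le> T"
    then have st: "0 \<le> s" "s < u" "u < t" "t \<le> T" by auto
    define p where "p = (t - s) powr \<alpha>"
    have p2: "(t - s) powr (2 * \<alpha>) = p * p" and p3: "(t - s) powr (3 * \<alpha>) = p * p * p"
      by (simp_all add: p_def powr_add[symmetric])
    have p: "0 \<le> p" "(u - s) powr \<alpha> \<le> p" "(t - u) powr \<alpha> \<le> p"
        "(u - s) powr (2 * \<alpha>) \<le> p * p" "(t - u) powr (2 * \<alpha>) \<le> p * p"
      using st \<alpha> unfolding p2[symmetric] by (auto simp: p_def intro!: powr_mono2)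
    have chen: "XX s t = XX s u + XX u t + tensor (X u - X s) (X t - X u)"
      using X st by (auto simp: rough_path_def algebra_simps dest!: spec[of _ s] spec[of _ u] spec[of _ t])
    define R where "R = Z u - Z s - blinfun_apply (Z' s) (X u - X s)"
    have diff_lift: "tensor_lift (\<lambda>y z. blinfun_apply (Z' u - Z' s) y *v z) S =
        tensor_lift (\<lambda>y z. blinfun_apply (Z' u) y *v z) S
        - tensor_lift (\<lambda>y z. blinfun_apply (Z' s) y *v z) S" for S
      by (simp add: tensor_lift_def blinfun.diff_left matrix_vector_mult_diff_rdistrib sum_subtractf)
    \<comment> \<open>The rank-one term of Chen's relation is lifted to \<open>Z' s\<close> applied
      to \<open>X u - X s\<close>, acting on \<open>X t - X u\<close>. It turns
      \<open>Z u - Z s\<close> into the remainder \<open>R\<close>.\<close>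
    have "?\<Xi> s u + ?\<Xi> u t - ?\<Xi> s t =
        R *v (X t - X u) + tensor_lift (\<lambda>y z. blinfun_apply (Z' u - Z' s) y *v z) (XX u t)"
    proof -
      have "?\<Xi> s t = Z s *v (X u - X s) + Z s *v (X t - X u)
          + tensor_lift (\<lambda>y z. blinfun_apply (Z' s) y *v z) (XX s u)
          + tensor_lift (\<lambda>y z. blinfun_apply (Z' s) y *v z) (XX u t)
          + blinfun_apply (Z' s) (X u - X s) *v (X t - X u)"
        by (simp add: rough_germ_def chen matrix_vector_right_distrib[symmetric]
          tensor_lift_add[OF bounded_bilinear_blinfun_matrix_vector_mult]
          tensor_lift_tensor[OF bounded_bilinear_blinfun_matrix_vector_mult])
      then show ?thesis
        by (simp add: rough_germ_def R_def diff_lift matrix_vector_mult_diff_rdistrib)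
    qed
    also have "norm \<dots> \<le> norm (R *v (X t - X u))
        + norm (tensor_lift (\<lambda>y z. blinfun_apply (Z' u - Z' s) y *v z) (XX u t))"
      by (rule norm_triangle_ineq)
    also have "\<dots> \<le> b * (\<bar>c4\<bar> * (p * p)) * (c1 * p) + D * (b * (c2 * p)) * (\<bar>c3\<bar> * (p * p))"
    proof (rule add_mono)
      have "norm R \<le> c4 * (u - s) powr (2 * \<alpha>)"
        using c4[of s u] st by (simp add: R_def)
      also have "\<dots> \<le> \<bar>c4\<bar> * (p * p)"
        using p by (intro mult_mono) auto
      finally have R: "norm R \<le> \<bar>c4\<bar> * (p * p)" .
      have "norm (X t - X u) \<le> c1 * (t - u) powr \<alpha>"
        using c1(2)[of u t] st by simp
      also have "\<dots> \<le> c1 * p"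
        using p c1 by (intro mult_left_mono) auto
      finally have dX: "norm (X t - X u) \<le> c1 * p" .
      show "norm (R *v (X t - X u)) \<le> b * (\<bar>c4\<bar> * (p * p)) * (c1 * p)"
        using R dX b(1) p c1 by (intro order_trans[OF b(2)] mult_mono mult_left_mono) auto
    next
      have "norm (Z' u - Z' s) \<le> c2 * (u - s) powr \<alpha>"
        using c2(2)[of s u] st by simp
      also have "\<dots> \<le> c2 * p"
        using p c2 by (intro mult_left_mono) auto
      finally have dZ: "norm (Z' u - Z' s) \<le> c2 * p" .
      have "norm (XX u t) \<le> c3 * (t - u) powr (2 * \<alpha>)"
        using c3[of u t] st by simp
      also have "\<dots> \<le> \<bar>c3\<bar> * (p * p)"
        using p by (intro mult_mono) auto
      finally have XX: "norm (XX u t) \<le> \<bar>c3\<bar> * (p * p)" .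
      have "norm (blinfun_apply (Z' u - Z' s) y *v z) \<le> b * norm (Z' u - Z' s) * norm y * norm z" for y z
      proof -
        have "b * norm (blinfun_apply (Z' u - Z' s) y) * norm z
            \<le> b * (norm (Z' u - Z' s) * norm y) * norm z"
          using b by (intro mult_right_mono mult_left_mono norm_blinfun) auto
        with b(2) show ?thesis
          by (auto intro: order_trans simp: mult.assoc)
      qed
      then have "norm (tensor_lift (\<lambda>y z. blinfun_apply (Z' u - Z' s) y *v z) (XX u t))
          \<le> D * (b * norm (Z' u - Z' s)) * norm (XX u t)"
        unfolding D_def using b by (intro norm_tensor_lift_le) auto
      also have "\<dots> \<le> D * (b * (c2 * p)) * (\<bar>c3\<bar> * (p * p))"
        using dZ XX b p c2 by (intro mult_mono mult_left_mono) (auto simp: D_def)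
      finally show "norm (tensor_lift (\<lambda>y z. blinfun_apply (Z' u - Z' s) y *v z) (XX u t))
          \<le> D * (b * (c2 * p)) * (\<bar>c3\<bar> * (p * p))" .
    qed
    also have "\<dots> = C * (t - s) powr (3 * \<alpha>)"
      unfolding C_def p3 by (simp add: algebra_simps)
    finally show "norm (?\<Xi> s u + ?\<Xi> u t - ?\<Xi> s t) \<le> C * (t - s) powr (3 * \<alpha>)" .
  qed
qed

text \<open>Sewing applies since 3\<alpha> > 1. The sewn path is also the limit of the partition
  sums, so the integral over \<open>[0, t]\<close> is its increment and inherits the local
  expansion.\<close>

lemma rough_integral_increment:
  fixes Z :: "real \<Rightarrow> real^'m^'n"
  assumes \<alpha>: "1/3 < \<alpha>" and T: "0 < T"
    and X: "rough_path \<alpha> T X XX" and Z: "controlled2 \<alpha> T X Z Z'"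
  shows "\<exists>C. \<forall>s t. 0 \<le> s \<and> s < t \<and> t \<le> T \<longrightarrow>
    norm (rough_integral X XX Z Z' 0 t - rough_integral X XX Z Z' 0 s - Z s *v (X t - X s)
        - tensor_lift (\<lambda>y z. blinfun_apply (Z' s) y *v z) (XX s t))
      \<le> C * (t - s) powr (3 * \<alpha>)"
proof -
  let ?\<Xi> = "rough_germ X XX Z Z'"
  \<comment> \<open>\<open>rough_path\<close> says nothing about \<open>XX u u\<close>, so the germ
    is set to 0 on the diagonal by hand; partition sums never evaluate it there.\<close>
  define \<Xi> where "\<Xi> u v = (if u = v then 0 else ?\<Xi> u v)" for u v
  have "0 < \<alpha>" using \<alpha> by simp
  then obtain C where C: "0 \<le> C" "\<forall>s u t. 0 \<le> s \<and> s < u \<and> u < t \<and> t \<le> T \<longrightarrow>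
      norm (?\<Xi> s u + ?\<Xi> u t - ?\<Xi> s t) \<le> C * (t - s) powr (3 * \<alpha>)"
    using rough_germ_defect[OF _ X Z] by blast
  interpret almost_additive \<Xi> C "3 * \<alpha>" T
  proof
    fix s u t :: real assume "0 \<le> s" "s \<le> u" "u \<le> t" "t \<le> T"
    then show "norm (\<Xi> s u + \<Xi> u t - \<Xi> s t) \<le> C * (t - s) powr (3 * \<alpha>)"
      using C by (cases "s = u"; cases "u = t") (auto simp: \<Xi>_def)
  qed (use \<alpha> T in \<open>auto simp: \<Xi>_def\<close>)
  obtain I K where I: "\<forall>s t. 0 \<le> s \<and> s < t \<and> t \<le> T \<longrightarrow>
      norm (I t - I s - \<Xi> s t) \<le> K * (t - s) powr (3 * \<alpha>)"
    using sewing by blast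
  have I: "norm (I t - I s - ?\<Xi> s t) \<le> K * (t - s) powr (3 * \<alpha>)"
    if "0 \<le> s" "s < t" "t \<le> T" for s t
    using spec[OF spec[OF I, of s], of t] that by (simp add: \<Xi>_def)
  have integral: "rough_integral X XX Z Z' 0 t = I t - I 0" if "0 \<le> t" "t \<le> T" for t
  proof -
    have "(partition_sum ?\<Xi> \<longlongrightarrow> I t - I 0) (mesh_filter 0 t)"
      using that \<alpha> by (intro partition_sum_tendsto[of "3 * \<alpha>" _ _ _ _ K] I) auto
    with mesh_filter_neq_bot[of 0 t] that have "Lim (mesh_filter 0 t) (partition_sum ?\<Xi>) = I t - I 0"
      by (intro tendsto_Lim) auto
    then show ?thesis
      by (simp add: rough_integral_def rough_germ_def[abs_def])
  qed
  show ?thesis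
  proof (intro exI[of _ K] allI impI)
    fix s t assume "0 \<le> s \<and> s < t \<and> t \<le> T"
    then show "norm (rough_integral X XX Z Z' 0 t - rough_integral X XX Z Z' 0 s - Z s *v (X t - X s)
        - tensor_lift (\<lambda>y z. blinfun_apply (Z' s) y *v z) (XX s t)) \<le> K * (t - s) powr (3 * \<alpha>)"
      using I[of s t] by (simp add: integral rough_germ_def diff_diff_eq add.assoc)
  qed
qed

section \<open>The joint lift\<close>

lemma sum_Basis_prod:
  fixes f :: "'v::euclidean_space \<times> 'w::euclidean_space \<Rightarrow> 'b::comm_monoid_add"
  shows "sum f Basis = (\<Sum>i\<in>Basis. f (i, 0)) + (\<Sum>i\<in>Basis. f (0, i))"
  unfolding Basis_prod_def
  by (subst sum.union_disjoint) (auto simp: sum.reindex inj_on_def)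

text \<open>
  The integrands and integrators in both integrals are equal as functions, so \<open>ito_integral\<close> picks
  the same version for both.
\<close>

lemma snd_ito_increment_Pair:
  "snd (blinfun_apply (ito_increment P F T H (\<lambda>t \<omega>. (K t \<omega>, L t \<omega>)) s t \<omega>) x) =
    blinfun_apply (ito_increment P F T H L s t \<omega>) x"
proof -
  have "snd (blinfun_apply (ito_tensor_integral P F T H (\<lambda>t \<omega>. (K t \<omega>, L t \<omega>)) t \<omega>) x) =
      blinfun_apply (ito_tensor_integral P F T H L t \<omega>) x" for t
    by (simp add: ito_tensor_integral_def sum_Basis_prod blinfun.sum_left blinfun.add_left
      blinfun.scaleR_left snd_sum)
  then show ?thesis
    by (simp add: ito_increment_def blinfun.diff_left)
qed

text \<open>Tested against a vector, transposition moves \<open>(0, e)\<close> to the integrator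
  side, where it sees only the second component. This extracts the block \<Pi>(N; X) from the lift
  with \<open>(M, N)\<close>.\<close>

lemma Pi_LX_Pair:
  "blinfun_apply (Pi_LX P F T (\<lambda>t \<omega>. (K t \<omega>, L t \<omega>)) X s t \<omega>) (0, e) =
    blinfun_apply (Pi_LX P F T L X s t \<omega>) e"
  by (rule vector_eq_ldot[THEN iffD1])
    (simp add: Pi_LX_def Pi_XL_def blinfun.diff_left inner_diff_right tensor_transpose_inner
      snd_ito_increment_Pair inner_prod_def)

text \<open>Both sides equal \<open>L t \<omega> \<otimes> X t - L s \<omega> \<otimes> X s\<close>
  minus the transposed increment of one fixed version of the Ito integral process. The identity is
  therefore algebraic and holds for every \<open>\<omega>\<close> and all times at once.\<close>

lemma Pi_LX_increment:
  "(Pi_LX P F T L X 0 t \<omega> + tensor (L 0 \<omega>) (X t - X 0))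
      - (Pi_LX P F T L X 0 s \<omega> + tensor (L 0 \<omega>) (X s - X 0)) =
    Pi_LX P F T L X s t \<omega> + tensor (L s \<omega>) (X t - X s)"
proof (rule blinfun_eqI, rule vector_eq_ldot[THEN iffD1], rule allI)
  fix y x
  show "x \<bullet> blinfun_apply ((Pi_LX P F T L X 0 t \<omega> + tensor (L 0 \<omega>) (X t - X 0))
      - (Pi_LX P F T L X 0 s \<omega> + tensor (L 0 \<omega>) (X s - X 0))) y =
    x \<bullet> blinfun_apply (Pi_LX P F T L X s t \<omega> + tensor (L s \<omega>) (X t - X s)) y"
    by (simp add: Pi_LX_def Pi_XL_def ito_increment_def blinfun.diff_left blinfun.add_left
      inner_diff_right inner_diff_left inner_add_left inner_add_right tensor_transpose_inner
      inner_commute[of y] algebra_simps)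
qed

section \<open>The joint derivatives: evaluation on the lift, continuity and control\<close>

lemma joint_deriv_eq:
  "blinfun_apply (joint_deriv DY t \<omega>) z = DY t \<omega> *v fst z + fst (snd z)"
  by (cases z) (simp add: joint_deriv_apply)

lemma joint_deriv2_eq:
  "blinfun_apply (blinfun_apply (joint_deriv2 D2Y t \<omega>) y) z =
    blinfun_apply (D2Y t \<omega>) (fst y) *v fst z + snd (snd y) *v fst z"
  by (cases y; cases z) (simp add: joint_deriv2_apply)

text \<open>Split the basis by components. The second derivative reads only the
  \<open>X\<close>-component of its second argument, so basis vectors of \<open>X\<close> give
  \<open>XX\<close>, those of \<open>M\<close> give 0, and those of \<open>N\<close> give the
  contraction of \<Pi>(N; X).\<close>

lemma tensor_lift_joint_deriv2:
  fixes M :: "real \<Rightarrow> 'a \<Rightarrow> real^'n" and N :: "real \<Rightarrow> 'a \<Rightarrow> real^'m^'n"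
  shows "tensor_lift (\<lambda>y z. blinfun_apply (blinfun_apply (joint_deriv2 D2Y s \<omega>) y) z)
      (joint_lift P F T X XX (\<lambda>t \<omega>. (M t \<omega>, N t \<omega>)) \<omega> s t) =
    tensor_lift (\<lambda>y z. blinfun_apply (D2Y s \<omega>) y *v z) (XX s t)
      + tensor_lift (*v) (Pi_LX P F T N X s t \<omega>)"
proof -
  have "(\<Sum>i\<in>Basis. i *v blinfun_apply (Pi_LX P F T (\<lambda>t \<omega>. (M t \<omega>, N t \<omega>)) X s t \<omega>) (0, i)) =
      (\<Sum>i\<in>Basis. i *v blinfun_apply (Pi_LX P F T N X s t \<omega>) i)"
    by (simp only: Pi_LX_Pair)
  then show ?thesis
    by (simp add: tensor_lift_def joint_lift_def joint_deriv2_eq sum_Basis_prod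
      tensor_block_apply blinfun.zero_right)
qed

text \<open>The derivative depends affinely on the current matrix, and the identity block cancels in
  differences. Constant processes express this dependence on the value alone, with \<open>t\<close>
  and \<open>\<omega>\<close> as dummies, so that continuity and measurability follow by
  composition.\<close>

lemma joint_deriv_lipschitz:
  obtains K where "K-lipschitz_on UNIV (\<lambda>A :: real^'m^'n. joint_deriv (\<lambda>_ _. A) t \<omega>)"
proof -
  obtain b where b: "0 < b" "\<And>(A :: real^'m^'n) (x :: real^'m). norm (A *v x) \<le> b * norm A * norm x"
    using norm_matrix_vector_mult_bound by blast
  have "b-lipschitz_on UNIV (\<lambda>A :: real^'m^'n. joint_deriv (\<lambda>_ _. A) t \<omega>)"
  proof (rule lipschitz_onI)
    fix A B :: "real^'m^'n"
    show "dist (joint_deriv (\<lambda>_ _. A) t \<omega>) (joint_deriv (\<lambda>_ _. B) t \<omega>) \<le> b * dist A B"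
      unfolding dist_norm
    proof (rule norm_blinfun_bound)
      fix z :: "(real^'m) \<times> (real^'n) \<times> (real^'m^'n)"
      have "norm (blinfun_apply (joint_deriv (\<lambda>_ _. A) t \<omega> - joint_deriv (\<lambda>_ _. B) t \<omega>) z)
          = norm ((A - B) *v fst z)"
        by (simp add: blinfun.diff_left joint_deriv_eq matrix_vector_mult_diff_rdistrib)
      also have "\<dots> \<le> b * norm (A - B) * norm z"
        using b norm_fst_le[of "fst z" "snd z"]
        by (intro order_trans[OF b(2)] mult_left_mono) auto
      finally show "norm (blinfun_apply (joint_deriv (\<lambda>_ _. A) t \<omega> - joint_deriv (\<lambda>_ _. B) t \<omega>) z)
          \<le> b * norm (A - B) * norm z" .
    qed (use b in simp)
  qed (use b in simp)
  then show ?thesis by (rule that)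
qed

text \<open>Again the identity block cancels in differences. Besides continuity, this transfers the
  Hoelder bound of \<open>D2Y\<close>.\<close>

lemma joint_deriv2_lipschitz:
  obtains K where
    "K-lipschitz_on UNIV (\<lambda>A :: (real^'m) \<Rightarrow>\<^sub>L (real^'m^'n). joint_deriv2 (\<lambda>_ _. A) t \<omega>)"
proof -
  obtain b where b: "0 < b" "\<And>(A :: real^'m^'n) (x :: real^'m). norm (A *v x) \<le> b * norm A * norm x"
    using norm_matrix_vector_mult_bound by blast
  have "b-lipschitz_on UNIV (\<lambda>A :: (real^'m) \<Rightarrow>\<^sub>L (real^'m^'n). joint_deriv2 (\<lambda>_ _. A) t \<omega>)"
  proof (rule lipschitz_onI)
    fix A B :: "(real^'m) \<Rightarrow>\<^sub>L (real^'m^'n)"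
    show "dist (joint_deriv2 (\<lambda>_ _. A) t \<omega>) (joint_deriv2 (\<lambda>_ _. B) t \<omega>) \<le> b * dist A B"
      unfolding dist_norm
    proof (intro norm_blinfun_bound mult_nonneg_nonneg)
      fix y z :: "(real^'m) \<times> (real^'n) \<times> (real^'m^'n)"
      have "norm (blinfun_apply (blinfun_apply
            (joint_deriv2 (\<lambda>_ _. A) t \<omega> - joint_deriv2 (\<lambda>_ _. B) t \<omega>) y) z)
          = norm (blinfun_apply (A - B) (fst y) *v fst z)"
        by (simp add: blinfun.diff_left joint_deriv2_eq matrix_vector_mult_diff_rdistrib)
      also have "\<dots> \<le> b * (norm (A - B) * norm y) * norm z"
      proof (intro order_trans[OF b(2)] mult_mono mult_left_mono)
        show "norm (blinfun_apply (A - B) (fst y)) \<le> norm (A - B) * norm y"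
          using norm_fst_le[of "fst y" "snd y"]
          by (intro order_trans[OF norm_blinfun] mult_left_mono) auto
        show "norm (fst z) \<le> norm z"
          using norm_fst_le[of "fst z" "snd z"] by simp
      qed (use b in auto)
      finally show "norm (blinfun_apply (blinfun_apply
            (joint_deriv2 (\<lambda>_ _. A) t \<omega> - joint_deriv2 (\<lambda>_ _. B) t \<omega>) y) z)
          \<le> b * norm (A - B) * norm y * norm z"
        by (simp add: mult.assoc)
    qed (use b in simp_all)
  qed (use b in simp)
  then show ?thesis by (rule that)
qed

lemma continuous_adapted_compose:
  assumes g: "continuous_on UNIV g" and Y: "continuous_adapted P F T Y"
  shows "continuous_adapted P F T (\<lambda>t \<omega>. g (Y t \<omega>))"
  unfolding continuous_adapted_def adapted_def
proof (intro conjI ballI)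
  fix t assume "t \<in> {0..T}"
  with Y have "Y t \<in> borel_measurable (F t)"
    by (simp add: continuous_adapted_def adapted_def)
  then show "(\<lambda>\<omega>. g (Y t \<omega>)) \<in> borel_measurable (F t)"
    by (rule measurable_compose[OF _ borel_measurable_continuous_onI[OF g]])
next
  show "AE \<omega> in P. continuous_on {0..T} (\<lambda>t. g (Y t \<omega>))"
    using Y unfolding continuous_adapted_def
    by (auto elim!: eventually_mono intro: continuous_on_compose2[OF g])
qed

text \<open>Applied to the increment of \<open>(X, M, N)\<close>, the second derivative produces
  \<open>D2Y\<close> on the increment of \<open>X\<close> plus the increment of \<open>N\<close>.
  The remainder of \<open>joint_deriv DY\<close> is thus the remainder of \<open>DY - N\<close>
  acting on the \<open>X\<close>-component, and the increment of \<open>M\<close> does not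
  enter.\<close>

lemma controlled2_joint:
  fixes DY :: "real \<Rightarrow> 'a \<Rightarrow> real^'m^'n" and M :: "real \<Rightarrow> 'a \<Rightarrow> real^'n"
  assumes "controlled2 \<alpha> T X (\<lambda>t. DY t \<omega> - N t \<omega>) (\<lambda>t. D2Y t \<omega>)"
  shows "controlled2 \<alpha> T (joint_path X (\<lambda>t \<omega>. (M t \<omega>, N t \<omega>)) \<omega>)
    (\<lambda>t. joint_deriv DY t \<omega>) (\<lambda>t. joint_deriv2 D2Y t \<omega>)"
  unfolding controlled2_def
proof
  obtain K where K: "K-lipschitz_on UNIV
      (\<lambda>A :: (real^'m) \<Rightarrow>\<^sub>L (real^'m^'n). joint_deriv2 (\<lambda>_ _. A) 0 \<omega>)"
    by (rule joint_deriv2_lipschitz)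
  obtain c where c: "\<And>s t. \<lbrakk>0 \<le> s; s < t; t \<le> T\<rbrakk> \<Longrightarrow>
      norm (D2Y t \<omega> - D2Y s \<omega>) \<le> c * (t - s) powr \<alpha>"
    using assms unfolding controlled2_def holder_on_def by blast
  show "holder_on \<alpha> T (\<lambda>t. joint_deriv2 D2Y t \<omega>)"
    unfolding holder_on_def
  proof (intro exI allI impI)
    fix s t assume st: "0 \<le> s \<and> s < t \<and> t \<le> T"
    have "norm (joint_deriv2 D2Y t \<omega> - joint_deriv2 D2Y s \<omega>) \<le> K * norm (D2Y t \<omega> - D2Y s \<omega>)"
      using lipschitz_onD[OF K, of "D2Y t \<omega>" "D2Y s \<omega>"] by (simp add: dist_norm joint_deriv2_def)
    also have "\<dots> \<le> K * (c * (t - s) powr \<alpha>)"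
      using st by (intro mult_left_mono c lipschitz_on_nonneg[OF K]) auto
    finally show "norm (joint_deriv2 D2Y t \<omega> - joint_deriv2 D2Y s \<omega>) \<le> (K * c) * (t - s) powr \<alpha>"
      by (simp add: mult.assoc)
  qed
next
  obtain b where b: "0 < b" "\<And>(A :: real^'m^'n) (x :: real^'m). norm (A *v x) \<le> b * norm A * norm x"
    using norm_matrix_vector_mult_bound by blast
  obtain c where c: "\<And>s t. \<lbrakk>0 \<le> s; s < t; t \<le> T\<rbrakk> \<Longrightarrow>
      norm (DY t \<omega> - N t \<omega> - (DY s \<omega> - N s \<omega>) - blinfun_apply (D2Y s \<omega>) (X t - X s))
        \<le> c * (t - s) powr (2 * \<alpha>)"
    using assms unfolding controlled2_def by blast
  let ?J = "joint_path X (\<lambda>t \<omega>. (M t \<omega>, N t \<omega>)) \<omega>"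
  show "\<exists>C. \<forall>s t. 0 \<le> s \<and> s < t \<and> t \<le> T \<longrightarrow>
      norm (joint_deriv DY t \<omega> - joint_deriv DY s \<omega>
        - blinfun_apply (joint_deriv2 D2Y s \<omega>) (?J t - ?J s)) \<le> C * (t - s) powr (2 * \<alpha>)"
  proof (intro exI allI impI)
    fix s t assume st: "0 \<le> s \<and> s < t \<and> t \<le> T"
    define R where "R = DY t \<omega> - N t \<omega> - (DY s \<omega> - N s \<omega>) - blinfun_apply (D2Y s \<omega>) (X t - X s)"
    have "norm (joint_deriv DY t \<omega> - joint_deriv DY s \<omega>
        - blinfun_apply (joint_deriv2 D2Y s \<omega>) (?J t - ?J s)) \<le> b * norm R"
    proof (rule norm_blinfun_bound)
      fix z :: "(real^'m) \<times> (real^'n) \<times> (real^'m^'n)"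
      have "blinfun_apply (joint_deriv DY t \<omega> - joint_deriv DY s \<omega>
          - blinfun_apply (joint_deriv2 D2Y s \<omega>) (?J t - ?J s)) z = R *v fst z"
        by (simp add: R_def joint_path_def blinfun.diff_left joint_deriv_eq joint_deriv2_eq
          matrix_vector_mult_diff_rdistrib)
      also have "norm \<dots> \<le> b * norm R * norm z"
        using b norm_fst_le[of "fst z" "snd z"]
        by (intro order_trans[OF b(2)] mult_left_mono) auto
      finally show "norm (blinfun_apply (joint_deriv DY t \<omega> - joint_deriv DY s \<omega>
          - blinfun_apply (joint_deriv2 D2Y s \<omega>) (?J t - ?J s)) z) \<le> b * norm R * norm z" .
    qed (use b in simp)
    also have "\<dots> \<le> b * (c * (t - s) powr (2 * \<alpha>))"
      unfolding R_def using st b by (intro mult_left_mono c) auto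
    finally show "norm (joint_deriv DY t \<omega> - joint_deriv DY s \<omega>
        - blinfun_apply (joint_deriv2 D2Y s \<omega>) (?J t - ?J s)) \<le> (b * c) * (t - s) powr (2 * \<alpha>)"
      by (simp add: mult.assoc)
  qed
qed

lemma rsm_integral_increment:
  fixes DY :: "real \<Rightarrow> 'a \<Rightarrow> real^'m^'n"
  shows "rsm_integral P F T X XX DY D2Y N t \<omega> - rsm_integral P F T X XX DY D2Y N s \<omega> =
    rough_integral X XX (\<lambda>r. DY r \<omega> - N r \<omega>) (\<lambda>r. D2Y r \<omega>) 0 t
      - rough_integral X XX (\<lambda>r. DY r \<omega> - N r \<omega>) (\<lambda>r. D2Y r \<omega>) 0 s
      + tensor_lift (*v) (Pi_LX P F T N X s t \<omega>) + N s \<omega> *v (X t - X s)"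
proof -
  note bil = bounded_bilinear_matrix_vector_mult
  have "tensor_lift (*v) (Pi_LX P F T N X 0 t \<omega> + tensor (N 0 \<omega>) (X t - X 0))
      - tensor_lift (*v) (Pi_LX P F T N X 0 s \<omega> + tensor (N 0 \<omega>) (X s - X 0))
      = tensor_lift (*v) (Pi_LX P F T N X s t \<omega>) + N s \<omega> *v (X t - X s)"
    unfolding tensor_lift_diff[OF bil, symmetric] Pi_LX_increment
    by (simp only: tensor_lift_add[OF bil] tensor_lift_tensor[OF bil])
  then show ?thesis
    by (simp add: rsm_integral_def algebra_simps)
qed

theorem proposition4p13:
  fixes P :: "'a measure" and F :: "real \<Rightarrow> 'a measure" and T \<alpha> :: real
    and X :: "real \<Rightarrow> real^'m" and XX :: "real \<Rightarrow> real \<Rightarrow> (real^'m) \<Rightarrow>\<^sub>L (real^'m)"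
    and Y :: "real \<Rightarrow> 'a \<Rightarrow> real^'n" and DY :: "real \<Rightarrow> 'a \<Rightarrow> real^'m^'n"
    and D2Y :: "real \<Rightarrow> 'a \<Rightarrow> (real^'m) \<Rightarrow>\<^sub>L (real^'m^'n)" and Yd :: "real \<Rightarrow> 'a \<Rightarrow> real^'n"
    and M :: "real \<Rightarrow> 'a \<Rightarrow> real^'n" and N :: "real \<Rightarrow> 'a \<Rightarrow> real^'m^'n"
  assumes "1/3 < \<alpha>" and "\<alpha> < 1/2" and "0 < T"
    and "usual_conditions P F T"
    and "rough_path \<alpha> T X XX"
    and "scRSM P F T \<alpha> X XX Y DY D2Y Yd M N"
  shows "continuous_adapted P F T (joint_deriv DY) \<and>
    continuous_adapted P F T (joint_deriv2 D2Y) \<and>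
    (AE \<omega> in P. controlled3 \<alpha> T
       (joint_path X (\<lambda>t \<omega>. (M t \<omega>, N t \<omega>)) \<omega>)
       (joint_lift P F T X XX (\<lambda>t \<omega>. (M t \<omega>, N t \<omega>)) \<omega>)
       (\<lambda>t. Y t \<omega> - (LINT s:{0..t}|lborel. Yd s \<omega>))
       (\<lambda>t. joint_deriv DY t \<omega>) (\<lambda>t. joint_deriv2 D2Y t \<omega>) (\<lambda>_. 0))"
proof (intro conjI)
  have DY: "continuous_adapted P F T DY" and D2Y: "continuous_adapted P F T D2Y"
    and rsm: "AE \<omega> in P. controlled2 \<alpha> T X (\<lambda>t. DY t \<omega> - N t \<omega>) (\<lambda>t. D2Y t \<omega>)"
    and dec: "AE \<omega> in P. \<forall>t\<in>{0..T}.
      Y t \<omega> = Y 0 \<omega> + (LINT s:{0..t}|lborel. Yd s \<omega>) + M t \<omega>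
              + rsm_integral P F T X XX DY D2Y N t \<omega>"
    using assms(6) by (auto simp: scRSM_def rough_semimartingale_def)
  \<comment> \<open>The time 0 and the sample point \<open>undefined\<close> are placeholders: the
    map is evaluated at constant processes.\<close>
  obtain K1 where K1: "K1-lipschitz_on UNIV
      (\<lambda>A :: real^'m^'n. joint_deriv (\<lambda>_ _. A) 0 undefined)"
    by (rule joint_deriv_lipschitz)
  show "continuous_adapted P F T (joint_deriv DY)"
    using continuous_adapted_compose[OF lipschitz_on_continuous_on[OF K1] DY]
    by (simp add: joint_deriv_def[abs_def])
  obtain K2 where K2: "K2-lipschitz_on UNIV
      (\<lambda>A :: (real^'m) \<Rightarrow>\<^sub>L (real^'m^'n). joint_deriv2 (\<lambda>_ _. A) 0 undefined)"
    by (rule joint_deriv2_lipschitz)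
  show "continuous_adapted P F T (joint_deriv2 D2Y)"
    using continuous_adapted_compose[OF lipschitz_on_continuous_on[OF K2] D2Y]
    by (simp add: joint_deriv2_def[abs_def])
  show "AE \<omega> in P. controlled3 \<alpha> T
       (joint_path X (\<lambda>t \<omega>. (M t \<omega>, N t \<omega>)) \<omega>)
       (joint_lift P F T X XX (\<lambda>t \<omega>. (M t \<omega>, N t \<omega>)) \<omega>)
       (\<lambda>t. Y t \<omega> - (LINT s:{0..t}|lborel. Yd s \<omega>))
       (\<lambda>t. joint_deriv DY t \<omega>) (\<lambda>t. joint_deriv2 D2Y t \<omega>) (\<lambda>_. 0)"
    using rsm dec
  proof eventually_elim
    case (elim \<omega>)
    let ?J = "joint_path X (\<lambda>t \<omega>. (M t \<omega>, N t \<omega>)) \<omega>"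
      and ?JJ = "joint_lift P F T X XX (\<lambda>t \<omega>. (M t \<omega>, N t \<omega>)) \<omega>"
      and ?U = "\<lambda>t. Y t \<omega> - (LINT s:{0..t}|lborel. Yd s \<omega>)"
    obtain C where C: "\<And>s t. \<lbrakk>0 \<le> s; s < t; t \<le> T\<rbrakk> \<Longrightarrow>
        norm (rough_integral X XX (\<lambda>r. DY r \<omega> - N r \<omega>) (\<lambda>r. D2Y r \<omega>) 0 t
            - rough_integral X XX (\<lambda>r. DY r \<omega> - N r \<omega>) (\<lambda>r. D2Y r \<omega>) 0 s
            - (DY s \<omega> - N s \<omega>) *v (X t - X s)
            - tensor_lift (\<lambda>y z. blinfun_apply (D2Y s \<omega>) y *v z) (XX s t))
          \<le> C * (t - s) powr (3 * \<alpha>)"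
      using rough_integral_increment[OF assms(1,3,5) elim(1)] by blast
    show ?case
      unfolding controlled3_def
    proof (intro conjI exI allI impI)
      show "controlled2 \<alpha> T ?J (\<lambda>t. joint_deriv DY t \<omega>) (\<lambda>t. joint_deriv2 D2Y t \<omega>)"
        using elim(1) by (rule controlled2_joint)
      show "holder_on \<alpha> T (\<lambda>_. 0 :: real^'n)"
        by (auto simp: holder_on_def intro: exI[of _ 0])
    next
      fix s t assume st: "0 \<le> s \<and> s < t \<and> t \<le> T"
      \<comment> \<open>Subtracting the drift leaves the martingale and the rough integral; the
        initial value cancels in the increment.\<close>
      have U: "?U t - ?U s = (M t \<omega> - M s \<omega>) + (rsm_integral P F T X XX DY D2Y N t \<omega>
          - rsm_integral P F T X XX DY D2Y N s \<omega>)"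
      proof -
        have "?U r = Y 0 \<omega> + M r \<omega> + rsm_integral P F T X XX DY D2Y N r \<omega>" if "r \<in> {s, t}" for r
          using bspec[OF elim(2), of r] that st by auto
        then show ?thesis by simp
      qed
      \<comment> \<open>The increment of \<open>M\<close> and the contraction of \<Pi>(N; X) cancel
        exactly. The term \<open>N s \<omega> *v (X t - X s)\<close> joins the \<open>DY\<close>
        term to form the coefficient \<open>DY s \<omega> - N s \<omega>\<close>, leaving precisely
        the error of the pathwise rough integral.\<close>
      have "?U t - ?U s - blinfun_apply (joint_deriv DY s \<omega>) (?J t - ?J s)
          - tensor_lift (\<lambda>y z. blinfun_apply (blinfun_apply (joint_deriv2 D2Y s \<omega>) y) z) (?JJ s t)
          - (t - s) *\<^sub>R 0
        = rough_integral X XX (\<lambda>r. DY r \<omega> - N r \<omega>) (\<lambda>r. D2Y r \<omega>) 0 t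
            - rough_integral X XX (\<lambda>r. DY r \<omega> - N r \<omega>) (\<lambda>r. D2Y r \<omega>) 0 s
            - (DY s \<omega> - N s \<omega>) *v (X t - X s)
            - tensor_lift (\<lambda>y z. blinfun_apply (D2Y s \<omega>) y *v z) (XX s t)"
        unfolding U rsm_integral_increment tensor_lift_joint_deriv2
        by (simp add: joint_deriv_eq joint_path_def matrix_vector_mult_diff_rdistrib)
      also have "norm \<dots> \<le> C * (t - s) powr (3 * \<alpha>)"
        using st by (intro C) auto
      finally show "norm (?U t - ?U s - blinfun_apply (joint_deriv DY s \<omega>) (?J t - ?J s)
          - tensor_lift (\<lambda>y z. blinfun_apply (blinfun_apply (joint_deriv2 D2Y s \<omega>) y) z) (?JJ s t)
          - (t - s) *\<^sub>R 0) \<le> C * (t - s) powr (3 * \<alpha>)" .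
    qed
  qed
qed

end
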